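(* Let $\delta>0$ and $f\in L^2(\Omega)$ be fixed, and let $1<p\le2$. Then the non-local compliance minimization problem $$\text{minimize } \ell(u)\quad\text{over }(\rho,u)\in\mathcal{A}^\delta\times\mathcal{U}_0^\delta\quad\text{subject to}\quad a_{\delta,\kappa}(u,v)=\ell(v)\ \ \forall v\in\mathcal{U}_0^\delta,\quad \kappa(x,x')=\rho^{p/2}(x)\rho^{p/2}(x'),$$ admits an optimal solution $(\rho^*,u^* )\in\mathcal{A}^\delta\times\mathcal{U}_0^\delta$.
   Context: $\Omega\subset\mathbb{R}^n$, $n\ge2$, is open, bounded and connected. For $\delta>0$, $B(x,\delta)$ is the open ball, and $\Omega_\delta=\bigcup_{x\in\Omega}B(x,\delta)$. Kernel: for every $\delta>0$, $A_\delta:\mathbb{R}_+\to\mathbb{R}_+$ satisfies $\frac1n\int_{\mathbb{R}^n}A_\delta(|x|)\,dx=1$ and $\operatorname{supp}A_\delta(|\cdot|)\subset B(0,\delta)$, and there exist $s\in(0,1)$ and $c_\delta>0$ such that $A_\delta(|x|)\ge c_\delta|x|^{-(n+2s-2)}$ for all $x\in B(0,\delta/2)\setminus\{0\}$, $\delta>0$. Bilinear form: for symmetric $\kappa\in L^\infty(\Omega_\delta\times\Omega_\delta)$ bounded between two positive constants, $$a_{\delta,\kappa}(u,v)=\int_{\Omega_\delta}\int_{\Omega_\delta}\kappa(x,x')A_\delta(|x-x'|)\frac{u(x)-u(x')}{|x-x'|}\frac{v(x)-v(x')}{|x-x'|}\,dx\,dx'.$$ Linear functional: $\ell(v)=\int_\Omega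 f(x)v(x)\,dx$. Spaces: $\mathcal{U}^\delta=\{u\in L^2(\Omega_\delta): a_{\delta,1}(u,u)<\infty\}$; $\mathcal{U}_0^\delta$ is the closure of $C_c^\infty(\Omega)$ (functions extended by $0$ outside $\Omega$) in $\mathcal{U}^\delta$ with respect to the norm $(\|u\|_{L^2(\Omega_\delta)}^2+a_{\delta,1}(u,u))^{1/2}$; its elements vanish a.e. in $\Omega_\delta\setminus\Omega$. The form $a_{\delta,1}$ is an inner product making $\mathcal{U}_0^\delta$ a Hilbert space. Admissible designs: given constants $0<\underline\rho<\overline\rho<\infty$ and $\gamma\in(\underline\rho,\overline\rho)$, $$\mathcal{A}^\delta=\Big\{\rho\in L^\infty(\Omega_\delta):\ \underline\rho\le\rho\le\overline\rho\ \text{a.e. in }\Omega_\delta,\ \int_\Omega\rho\,dx\le\gamma|\Omega|\Big\}.$$ An optimal solution is a feasible pair (i.e. one satisfying the constraint) whose objective value is no larger than that of any other feasible pair. *)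

theory Defs
  imports "HOL-Analysis.Analysis"
begin

text \<open>
  Elements of \<open>L\<^sup>2\<close> and \<open>L\<^sup>\<infinity>\<close> are rendered as representatives: total functions whose values
  outside the set \<open>S\<close> (and on null sets) are irrelevant.
\<close>

definition L2_on :: "'a::euclidean_space set \<Rightarrow> ('a \<Rightarrow> real) set" where
  "L2_on S = {u. u \<in> borel_measurable (lebesgue_on S) \<and> integrable (lebesgue_on S) (\<lambda>x. (u x)\<^sup>2)}"

definition Linf_on :: "'a::euclidean_space set \<Rightarrow> ('a \<Rightarrow> real) set" where
  "Linf_on S = {u. u \<in> borel_measurable (lebesgue_on S) \<and> (\<exists>C. AE x in lebesgue_on S. \<bar>u x\<bar> \<le> C)}"

definition fattening :: "'a::metric_space set \<Rightarrow> real \<Rightarrow> 'a set" where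
  "fattening \<Omega> \<delta> = (\<Union>x\<in>\<Omega>. ball x \<delta>)"

definition supp :: "('a::topological_space \<Rightarrow> 'b::zero) \<Rightarrow> 'a set" where
  "supp g = closure {x. g x \<noteq> 0}"

primrec Ck :: "nat \<Rightarrow> (real ^ 'n \<Rightarrow> real) \<Rightarrow> bool" where
  "Ck 0 \<phi> \<longleftrightarrow> continuous_on UNIV \<phi>"
| "Ck (Suc k) \<phi> \<longleftrightarrow> (\<forall>x. \<phi> differentiable (at x)) \<and>
     (\<forall>i. Ck k (\<lambda>x. frechet_derivative \<phi> (at x) (axis i 1)))"

text \<open>Test functions live on the whole space, i.e. they are already extended by \<open>0\<close> outside \<open>\<Omega>\<close>.\<close>

definition Cc_inf :: "(real ^ 'n) set \<Rightarrow> (real ^ 'n \<Rightarrow> real) set" where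
  "Cc_inf \<Omega> = {\<phi>. (\<forall>k. Ck k \<phi>) \<and> compact (supp \<phi>) \<and> supp \<phi> \<subseteq> \<Omega>}"

text \<open>
  Double integrals are taken with respect to the (completed) Lebesgue measure on the product
  space. The product of the two Lebesgue \<open>\<sigma>\<close>-algebras would not do: \<open>A \<delta> (norm (x - x'))\<close> need
  not be measurable for it. On the diagonal, a null set, the quotients are \<open>0\<close>.
\<close>

definition form_integrand ::
  "(real \<Rightarrow> real \<Rightarrow> real) \<Rightarrow> real \<Rightarrow> (real ^ 'n \<Rightarrow> real ^ 'n \<Rightarrow> real) \<Rightarrow>
    (real ^ 'n \<Rightarrow> real) \<Rightarrow> (real ^ 'n \<Rightarrow> real) \<Rightarrow> (real ^ 'n) \<times> (real ^ 'n) \<Rightarrow> real" where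
  "form_integrand A \<delta> \<kappa> u v = (\<lambda>(x, x').
     \<kappa> x x' * A \<delta> (norm (x - x')) *
       ((u x - u x') / norm (x - x')) * ((v x - v x') / norm (x - x')))"

definition nonlocal_form ::
  "(real ^ 'n) set \<Rightarrow> (real \<Rightarrow> real \<Rightarrow> real) \<Rightarrow> real \<Rightarrow> (real ^ 'n \<Rightarrow> real ^ 'n \<Rightarrow> real) \<Rightarrow>
    (real ^ 'n \<Rightarrow> real) \<Rightarrow> (real ^ 'n \<Rightarrow> real) \<Rightarrow> real" where
  "nonlocal_form \<Omega> A \<delta> \<kappa> u v =
     (LINT z|lebesgue_on (fattening \<Omega> \<delta> \<times> fattening \<Omega> \<delta>). form_integrand A \<delta> \<kappa> u v z)"

definition load :: "(real ^ 'n) set \<Rightarrow> (real ^ 'n \<Rightarrow> real) \<Rightarrow> (real ^ 'n \<Rightarrow> real) \<Rightarrow> real" where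
  "load \<Omega> f v = (LINT x|lebesgue_on \<Omega>. f x * v x)"

text \<open>
  For \<open>\<kappa> = 1\<close> and \<open>v = u\<close> the integrand is nonnegative, so finiteness of the energy is
  integrability of the integrand (the Bochner integral itself is always a real number).
\<close>

definition U_space :: "(real ^ 'n) set \<Rightarrow> (real \<Rightarrow> real \<Rightarrow> real) \<Rightarrow> real \<Rightarrow> (real ^ 'n \<Rightarrow> real) set" where
  "U_space \<Omega> A \<delta> = {u \<in> L2_on (fattening \<Omega> \<delta>).
     integrable (lebesgue_on (fattening \<Omega> \<delta> \<times> fattening \<Omega> \<delta>)) (form_integrand A \<delta> (\<lambda>_ _. 1) u u)}"

definition U_norm :: "(real ^ 'n) set \<Rightarrow> (real \<Rightarrow> real \<Rightarrow> real) \<Rightarrow> real \<Rightarrow> (real ^ 'n \<Rightarrow> real) \<Rightarrow> real" where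
  "U_norm \<Omega> A \<delta> u =
     sqrt ((LINT x|lebesgue_on (fattening \<Omega> \<delta>). (u x)\<^sup>2) + nonlocal_form \<Omega> A \<delta> (\<lambda>_ _. 1) u u)"

definition U0_space :: "(real ^ 'n) set \<Rightarrow> (real \<Rightarrow> real \<Rightarrow> real) \<Rightarrow> real \<Rightarrow> (real ^ 'n \<Rightarrow> real) set" where
  "U0_space \<Omega> A \<delta> =
     {u \<in> U_space \<Omega> A \<delta>. \<forall>\<epsilon>>0. \<exists>\<phi>\<in>Cc_inf \<Omega>. U_norm \<Omega> A \<delta> (\<lambda>x. u x - \<phi> x) < \<epsilon>}"

definition admissible :: "(real ^ 'n) set \<Rightarrow> real \<Rightarrow> real \<Rightarrow> real \<Rightarrow> real \<Rightarrow> (real ^ 'n \<Rightarrow> real) set" where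
  "admissible \<Omega> \<delta> \<rho>min \<rho>max \<gamma> = {\<rho> \<in> Linf_on (fattening \<Omega> \<delta>).
     (AE x in lebesgue_on (fattening \<Omega> \<delta>). \<rho>min \<le> \<rho> x \<and> \<rho> x \<le> \<rho>max) \<and>
     (LINT x|lebesgue_on \<Omega>. \<rho> x) \<le> \<gamma> * measure lebesgue \<Omega>}"

definition feasible ::
  "(real ^ 'n) set \<Rightarrow> (real \<Rightarrow> real \<Rightarrow> real) \<Rightarrow> real \<Rightarrow> real \<Rightarrow> real \<Rightarrow> real \<Rightarrow> real \<Rightarrow>
    (real ^ 'n \<Rightarrow> real) \<Rightarrow> ((real ^ 'n \<Rightarrow> real) \<times> (real ^ 'n \<Rightarrow> real)) set" where
  "feasible \<Omega> A \<delta> \<rho>min \<rho>max \<gamma> p f =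
     {(\<rho>, u) \<in> admissible \<Omega> \<delta> \<rho>min \<rho>max \<gamma> \<times> U0_space \<Omega> A \<delta>.
       \<forall>v\<in>U0_space \<Omega> A \<delta>.
         nonlocal_form \<Omega> A \<delta> (\<lambda>x x'. \<rho> x powr (p / 2) * \<rho> x' powr (p / 2)) u v = load \<Omega> f v}"

definition optimal ::
  "(real ^ 'n) set \<Rightarrow> (real \<Rightarrow> real \<Rightarrow> real) \<Rightarrow> real \<Rightarrow> real \<Rightarrow> real \<Rightarrow> real \<Rightarrow> real \<Rightarrow>
    (real ^ 'n \<Rightarrow> real) \<Rightarrow> (real ^ 'n \<Rightarrow> real) \<Rightarrow> (real ^ 'n \<Rightarrow> real) \<Rightarrow> bool" where
  "optimal \<Omega> A \<delta> \<rho>min \<rho>max \<gamma> p f \<rho> u \<longleftrightarrow>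
     (\<rho>, u) \<in> feasible \<Omega> A \<delta> \<rho>min \<rho>max \<gamma> p f \<and>
     (\<forall>(\<sigma>, w)\<in>feasible \<Omega> A \<delta> \<rho>min \<rho>max \<gamma> p f. load \<Omega> f u \<le> load \<Omega> f w)"

end

theory Submission
  imports Defs
begin

text \<open>
  The compliance of a design is a maximum. If \<open>u\<close> is the state that belongs to a coefficient
  \<open>\<kappa>\<close>, then \<open>2 \<ell>(w) - a\<^sub>\<kappa>(w, w) \<le> \<ell>(u)\<close> for every \<open>w\<close>, with equality at \<open>w = u\<close>
  (\<open>compliance_lower_bound\<close>). For a fixed \<open>w\<close>, the left-hand side sees the design only through the
  integral of \<open>\<rho>(x)\<^bsup>p/2\<^esup> \<rho>(x')\<^bsup>p/2\<^esup>\<close> against one fixed integrable function of \<open>(x, x')\<close>. The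
  compliance is therefore lower semicontinuous for every convergence of designs that respects
  these integrals, and the task is to find such a convergence in which the admissible designs are
  compact.

  The convergence is the weak one of the powers \<open>\<eta> = \<rho>\<^bsup>p/2\<^esup>\<close>, not of the designs themselves. Along a
  minimising sequence the \<open>\<eta>\<^sub>j\<close> are bounded, hence have a weak cluster point \<open>\<eta>\<^sub>0\<close> in \<open>L\<^sup>2\<close>
  (\<open>square_integrable_weak_cluster_point\<close>). The products \<open>\<eta>\<^sub>j(x) \<eta>\<^sub>j(x')\<close> then converge weakly to
  \<open>\<eta>\<^sub>0(x) \<eta>\<^sub>0(x')\<close>, because they do so on rectangles (\<open>weak_limit_tensor\<close>). The design
  \<open>\<rho> = \<eta>\<^sub>0\<^bsup>2/p\<^esup>\<close> obeys the volume constraint: since \<open>p \<le> 2\<close>, the function \<open>t\<^bsup>2/p\<^esup>\<close> is convex, so its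
  integral can only drop in a weak limit (\<open>weak_limit_integral_powr_le\<close>). With \<open>u\<close> the state of
  \<open>\<rho>\<close>, the bound \<open>2 \<ell>(u) - a\<^sub>j(u, u) \<le> \<ell>(u\<^sub>j)\<close> tends to \<open>2 \<ell>(u) - a\<^sub>\<rho>(u, u) = \<ell>(u)\<close> on the left
  and to the infimum on the right, so \<open>(\<rho>, u)\<close> is optimal (\<open>exists_optimal_design\<close>).

  It remains to know that every admissible design has a state (\<open>exists_solution\<close>). It is the limit
  of test functions that minimise \<open>a\<^sub>\<kappa>(v, v) - 2 \<ell>(v)\<close>. By the parallelogram law such a sequence,
  if it minimises fast enough, has geometrically small increments for \<open>a\<^sub>\<kappa>\<close>. The nonlocal Poincare inequality (\<open>nonlocal_Poincare\<close>) makes them small in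
  \<open>L\<^sup>2\<close>, so the sequence converges almost everywhere along with its difference quotients, and
  Fatou's lemma turns this into convergence in the energy norm. The Poincare inequality holds since
  a function that vanishes outside a bounded set is, at each point, a sum of a fixed number of its own
  increments by any step \<open>h\<close> that is not too short (\<open>translation_Poincare\<close>); averaging over a ball of
  steps \<open>h\<close> with \<open>\<delta>/4 < |h| < \<delta>/2\<close>, where the kernel is bounded below, gives the energy.
\<close>

section \<open>Square-integrable functions\<close>

text \<open>
  \<open>L2_on\<close> for an arbitrary measure: it is needed for Lebesgue measure on a set and on its square, and
  for Borel measures whose products are again Borel measures.
\<close>

definition square_integrable :: "'a measure \<Rightarrow> ('a \<Rightarrow> real) set" where
  "square_integrable M = {u. u \<in> borel_measurable M \<and> integrable M (\<lambda>x. (u x)\<^sup>2)}"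

lemma square_integrable_mult:
  assumes "u \<in> square_integrable M" "v \<in> square_integrable M"
  shows "integrable M (\<lambda>x. u x * v x)"
proof (rule Bochner_Integration.integrable_bound)
  show "integrable M (\<lambda>x. (u x)\<^sup>2 + (v x)\<^sup>2)"
    using assms by (simp add: square_integrable_def)
  show "(\<lambda>x. u x * v x) \<in> borel_measurable M"
    using assms by (auto simp: square_integrable_def)
  have "\<bar>u x * v x\<bar> \<le> (u x)\<^sup>2 + (v x)\<^sup>2" for x
  proof -
    have "2 * \<bar>u x\<bar> * \<bar>v x\<bar> \<le> \<bar>u x\<bar>\<^sup>2 + \<bar>v x\<bar>\<^sup>2" by (rule sum_squares_bound)
    moreover have "0 \<le> \<bar>u x\<bar> * \<bar>v x\<bar>" by simp
    ultimately show ?thesis unfolding abs_mult power2_abs by linarith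
  qed
  then show "AE x in M. norm (u x * v x) \<le> norm ((u x)\<^sup>2 + (v x)\<^sup>2)"
    by (intro AE_I2) (simp add: abs_of_nonneg)
qed

lemma square_integrable_comb:
  assumes "u \<in> square_integrable M" "v \<in> square_integrable M"
  shows "(\<lambda>x. u x + c * v x) \<in> square_integrable M"
proof -
  have "integrable M (\<lambda>x. (u x)\<^sup>2 + (2 * c) * (u x * v x) + c\<^sup>2 * (v x)\<^sup>2)"
    using assms square_integrable_mult[OF assms] by (auto simp: square_integrable_def)
  moreover have "(u x)\<^sup>2 + (2 * c) * (u x * v x) + c\<^sup>2 * (v x)\<^sup>2 = (u x + c * v x)\<^sup>2" for x
    by (simp add: power2_eq_square algebra_simps)
  ultimately show ?thesis using assms by (auto simp: square_integrable_def)
qed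

lemma square_integrable_diff:
  assumes "u \<in> square_integrable M" "v \<in> square_integrable M"
  shows "(\<lambda>x. u x - v x) \<in> square_integrable M"
  using square_integrable_comb[OF assms, of "-1"] by simp

text \<open>
  Almost everywhere convergence and a bound on the norms are all that the limits below come with, so
  lower semicontinuity of the norm has to come from Fatou's lemma.
\<close>

lemma square_integrable_Fatou:
  fixes v :: "nat \<Rightarrow> 'a \<Rightarrow> real"
  assumes v: "\<And>j. v j \<in> square_integrable M"
    and lim: "AE x in M. (\<lambda>j. v j x) \<longlonglongrightarrow> u x"
    and u: "u \<in> borel_measurable M"
    and bound: "eventually (\<lambda>j. (LINT x|M. (v j x)\<^sup>2) \<le> c) sequentially"
  shows "u \<in> square_integrable M" and "(LINT x|M. (u x)\<^sup>2) \<le> c"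
proof -
  have vi: "integrable M (\<lambda>x. (v j x)\<^sup>2)" and vm [measurable]: "v j \<in> borel_measurable M" for j
    using v by (auto simp: square_integrable_def)
  obtain j0 where j0: "(LINT x|M. (v j0 x)\<^sup>2) \<le> c"
    using bound by (auto simp: eventually_sequentially)
  have c: "0 \<le> c"
    by (rule order_trans[OF _ j0]) simp
  have "(\<integral>\<^sup>+x. ennreal ((u x)\<^sup>2) \<partial>M) = (\<integral>\<^sup>+x. liminf (\<lambda>j. ennreal ((v j x)\<^sup>2)) \<partial>M)"
    using lim
  proof (intro nn_integral_cong_AE, eventually_elim)
    case (elim x)
    then have "(\<lambda>j. ennreal ((v j x)\<^sup>2)) \<longlonglongrightarrow> ennreal ((u x)\<^sup>2)"
      by (intro tendsto_intros tendsto_ennrealI)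
    then show ?case
      by (metis lim_imp_Liminf sequentially_bot)
  qed
  also have "\<dots> \<le> liminf (\<lambda>j. \<integral>\<^sup>+x. ennreal ((v j x)\<^sup>2) \<partial>M)"
    by (rule nn_integral_liminf) simp
  also have "\<dots> = liminf (\<lambda>j. ennreal (LINT x|M. (v j x)\<^sup>2))"
    using vi by (simp add: nn_integral_eq_integral)
  also have "\<dots> \<le> ennreal c"
  proof (rule Liminf_le)
    show "eventually (\<lambda>j. ennreal (LINT x|M. (v j x)\<^sup>2) \<le> ennreal c) sequentially"
      using bound by eventually_elim (rule ennreal_leI)
  qed simp
  finally have le: "(\<integral>\<^sup>+x. ennreal ((u x)\<^sup>2) \<partial>M) \<le> ennreal c" .
  then have int: "integrable M (\<lambda>x. (u x)\<^sup>2)"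
    using u by (intro integrableI_bounded) (auto simp: le_less_trans[OF le])
  then show "u \<in> square_integrable M"
    using u by (simp add: square_integrable_def)
  show "(LINT x|M. (u x)\<^sup>2) \<le> c"
    using le int c by (simp add: nn_integral_eq_integral)
qed

text \<open>
  A sequence whose increments have geometrically small norms converges almost everywhere, also when
  the measure is infinite: \<open>|t| \<le> 2\<^bsup>-j\<^esup> + 2\<^sup>j t\<^sup>2\<close> bounds the sum of the increments by a constant plus
  an integrable sum of squares.
\<close>

lemma square_integrable_Cauchy_AE_convergent:
  fixes v :: "nat \<Rightarrow> 'a \<Rightarrow> real"
  assumes v: "\<And>j. v j \<in> square_integrable M"
    and fast: "\<And>j. (LINT x|M. (v (Suc j) x - v j x)\<^sup>2) \<le> C / 4 ^ j"
  shows "AE x in M. convergent (\<lambda>j. v j x)"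
proof -
  define d where "d j x = 2 ^ j * (v (Suc j) x - v j x)\<^sup>2" for j x
  have dd: "(\<lambda>x. v (Suc j) x - v j x) \<in> square_integrable M" for j
    using v by (intro square_integrable_diff)
  then have di: "integrable M (d j)" for j
    unfolding d_def square_integrable_def by simp
  have [measurable]: "d j \<in> borel_measurable M" for j
    using di by auto
  have C: "0 \<le> C"
    using order_trans[OF _ fast[of 0]] by simp
  have dint: "(LINT x|M. d j x) \<le> C * (1/2) ^ j" for j
  proof -
    have "(LINT x|M. d j x) = 2 ^ j * (LINT x|M. (v (Suc j) x - v j x)\<^sup>2)"
      by (simp add: d_def)
    also have "\<dots> \<le> 2 ^ j * (C / 4 ^ j)"
      using fast by (intro mult_left_mono) auto
    also have "\<dots> = C * (1/2) ^ j"
      by (simp add: power_divide field_simps flip: power_mult_distrib)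
    finally show ?thesis .
  qed
  have "(\<integral>\<^sup>+x. (\<Sum>j. ennreal (d j x)) \<partial>M) = (\<Sum>j. \<integral>\<^sup>+x. ennreal (d j x) \<partial>M)"
    by (rule nn_integral_suminf) simp
  also have "\<dots> = (\<Sum>j. ennreal (LINT x|M. d j x))"
    using di by (subst nn_integral_eq_integral) (auto simp: d_def)
  also have "\<dots> \<le> (\<Sum>j. ennreal (C * (1/2) ^ j))"
    using dint by (intro suminf_le) (auto intro: ennreal_leI)
  also have "\<dots> = ennreal (\<Sum>j. C * (1/2) ^ j)"
    using C by (intro suminf_ennreal2) (auto intro: summable_mult summable_geometric)
  also have "\<dots> < \<infinity>" by simp
  finally have "AE x in M. (\<Sum>j. ennreal (d j x)) \<noteq> \<infinity>"
    by (intro nn_integral_noteq_infinite) auto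
  then show ?thesis
  proof eventually_elim
    case (elim x)
    have "summable (\<lambda>j. d j x)"
      using elim by (intro summable_suminf_not_top) (auto simp: d_def)
    then have s: "summable (\<lambda>j. (1/2) ^ j + d j x)"
      by (intro summable_add summable_geometric) auto
    have "\<bar>v (Suc j) x - v j x\<bar> \<le> (1/2) ^ j + d j x" for j
    proof -
      define e :: real where "e = 2 ^ j"
      define t where "t = \<bar>v (Suc j) x - v j x\<bar>"
      have e: "e > 0" by (simp add: e_def)
      have "0 \<le> (e * t - 1)\<^sup>2 + e * t"
        using e by (simp add: t_def)
      then have "t * e \<le> 1 + e\<^sup>2 * t\<^sup>2"
        by (simp add: power2_eq_square algebra_simps)
      then have "t \<le> 1 / e + e * t\<^sup>2"
        using e by (simp add: field_simps power2_eq_square)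
      then show ?thesis by (simp add: e_def t_def d_def power_divide)
    qed
    then have "summable (\<lambda>j. v (Suc j) x - v j x)"
      by (intro summable_comparison_test'[OF s]) auto
    then have "convergent (\<lambda>n. \<Sum>j<n. v (Suc j) x - v j x)"
      by (simp add: summable_iff_convergent)
    then have "convergent (\<lambda>n. v n x - v 0 x)"
      unfolding sum_lessThan_telescope[of "\<lambda>j. v j x"] .
    then have "convergent (\<lambda>n. (v n x - v 0 x) + v 0 x)"
      by (rule convergent_add) (rule convergent_const)
    then show ?case by simp
  qed
qed

text \<open>
  Completeness of \<open>L\<^sup>2\<close>, in the form with an almost everywhere limit: pointwise convergence is what
  carries over to the difference quotients of the sequence.
\<close>

lemma square_integrable_Cauchy_limit:
  fixes v :: "nat \<Rightarrow> 'a \<Rightarrow> real"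
  assumes v: "\<And>j. v j \<in> square_integrable M"
    and fast: "\<And>i j. i \<le> j \<Longrightarrow> (LINT x|M. (v j x - v i x)\<^sup>2) \<le> C / 4 ^ i"
  obtains u where "u \<in> square_integrable M"
    and "AE x in M. (\<lambda>j. v j x) \<longlonglongrightarrow> u x"
    and "\<And>i. (LINT x|M. (u x - v i x)\<^sup>2) \<le> C / 4 ^ i"
proof -
  define u where "u x = lim (\<lambda>j. v j x)" for x
  have [measurable]: "v j \<in> borel_measurable M" for j
    using v by (simp add: square_integrable_def)
  have u [measurable]: "u \<in> borel_measurable M"
    unfolding u_def by measurable
  have lim: "AE x in M. (\<lambda>j. v j x) \<longlonglongrightarrow> u x"
    using square_integrable_Cauchy_AE_convergent[OF v fast]
    unfolding u_def convergent_LIMSEQ_iff by simp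
  have A: "(\<lambda>x. u x - v i x) \<in> square_integrable M"
          "(LINT x|M. (u x - v i x)\<^sup>2) \<le> C / 4 ^ i" for i
  proof -
    have 1: "(\<lambda>x. v j x - v i x) \<in> square_integrable M" for j
      using v by (intro square_integrable_diff)
    have 2: "AE x in M. (\<lambda>j. v j x - v i x) \<longlonglongrightarrow> u x - v i x"
      using lim by eventually_elim (intro tendsto_intros)
    have 3: "(\<lambda>x. u x - v i x) \<in> borel_measurable M" by measurable
    have 4: "eventually (\<lambda>j. (LINT x|M. (v j x - v i x)\<^sup>2) \<le> C / 4 ^ i) sequentially"
      using fast eventually_sequentially by blast
    from square_integrable_Fatou[OF 1 2 3 4]
    show "(\<lambda>x. u x - v i x) \<in> square_integrable M" "(LINT x|M. (u x - v i x)\<^sup>2) \<le> C / 4 ^ i" .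
  qed
  have "u \<in> square_integrable M"
    using square_integrable_comb[OF A(1)[of 0] v[of 0], of 1] by simp
  then show ?thesis using lim A(2) that by blast
qed

section \<open>Bounded functionals and minimising sequences\<close>

lemma inverse_power4_tendsto_0: "(\<lambda>j. 1 / 4 ^ j * c :: real) \<longlonglongrightarrow> 0"
  by (intro tendsto_mult_left_zero LIMSEQ_divide_realpow_zero) simp

lemma tendsto_0_if_square_le:
  fixes a b :: "'b \<Rightarrow> real"
  assumes "\<And>j. (a j)\<^sup>2 \<le> b j" and "(b \<longlongrightarrow> 0) F"
  shows "(a \<longlongrightarrow> 0) F"
proof -
  have "((\<lambda>j. (a j)\<^sup>2) \<longlongrightarrow> 0) F"
    by (rule tendsto_sandwich[OF _ _ tendsto_const assms(2)]) (simp_all add: assms(1))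
  then show ?thesis
    by (simp add: power_tendsto_0_iff)
qed

text \<open>
  Semidefinite and not definite, because the functions here are representatives: a form given by an
  integral vanishes at every function that is zero almost everywhere.
\<close>

locale nonneg_form =
  fixes V :: "('a \<Rightarrow> real) set" and B :: "('a \<Rightarrow> real) \<Rightarrow> ('a \<Rightarrow> real) \<Rightarrow> real"
  assumes nonempty: "V \<noteq> {}"
    and comb: "\<And>u v c. u \<in> V \<Longrightarrow> v \<in> V \<Longrightarrow> (\<lambda>x. u x + c * v x) \<in> V"
    and sym: "\<And>u v. u \<in> V \<Longrightarrow> v \<in> V \<Longrightarrow> B u v = B v u"
    and lin: "\<And>u v w c. u \<in> V \<Longrightarrow> v \<in> V \<Longrightarrow> w \<in> V \<Longrightarrow>
                B (\<lambda>x. u x + c * v x) w = B u w + c * B v w"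
    and nonneg: "\<And>u. u \<in> V \<Longrightarrow> 0 \<le> B u u"
begin

lemma diff: "u \<in> V \<Longrightarrow> v \<in> V \<Longrightarrow> (\<lambda>x. u x - v x) \<in> V"
  using comb[of u v "-1"] by simp

lemma lin_diff: "u \<in> V \<Longrightarrow> v \<in> V \<Longrightarrow> w \<in> V \<Longrightarrow> B (\<lambda>x. u x - v x) w = B u w - B v w"
  using lin[of u v w "-1"] by simp

lemma quadratic:
  assumes "u \<in> V" "v \<in> V"
  shows "B (\<lambda>x. u x + c * v x) (\<lambda>x. u x + c * v x) = B u u + 2 * c * B u v + c\<^sup>2 * B v v"
proof -
  have "B (\<lambda>x. u x + c * v x) (\<lambda>x. u x + c * v x)
      = B u (\<lambda>x. u x + c * v x) + c * B v (\<lambda>x. u x + c * v x)"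
    using assms comb by (intro lin) auto
  also have "B u (\<lambda>x. u x + c * v x) = B u u + c * B v u"
    using assms comb sym[of u "\<lambda>x. u x + c * v x"] lin[of u v u c] by simp
  also have "B v (\<lambda>x. u x + c * v x) = B u v + c * B v v"
    using assms comb sym[of v "\<lambda>x. u x + c * v x"] lin[of u v v c] by simp
  finally show ?thesis
    using sym[OF assms] by (simp add: power2_eq_square algebra_simps)
qed

lemma quadratic_diff:
  assumes "u \<in> V" "v \<in> V"
  shows "B (\<lambda>x. u x - v x) (\<lambda>x. u x - v x) = B u u - 2 * B u v + B v v"
  using quadratic[OF assms, of "-1"] by simp

end

text \<open>
  The sign of a discriminant, used in two ways: with \<open>e = B u u\<close> it is the Cauchy-Schwarz inequality,
  and with \<open>e\<close> the gap to the infimum of a quadratic functional it says how nearly a near-minimiser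
  satisfies the Euler-Lagrange equation.
\<close>

lemma discriminant_bound:
  fixes a b e :: real
  assumes "\<And>t. 0 \<le> e + 2 * t * b + t\<^sup>2 * a" "0 \<le> a"
  shows "b\<^sup>2 \<le> e * a"
proof (cases "a = 0")
  case True
  have "b = 0"
  proof (rule ccontr)
    assume "b \<noteq> 0"
    then show False using assms(1)[of "- (e + 1) / (2 * b)"] True by (simp add: field_simps)
  qed
  then show ?thesis using True by simp
next
  case False
  with assms(2) have "a > 0" by simp
  then show ?thesis using assms(1)[of "- b / a"]
    by (simp add: field_simps power2_eq_square)
qed

context nonneg_form
begin

lemma Cauchy_Schwarz:
  assumes "u \<in> V" "v \<in> V"
  shows "(B u v)\<^sup>2 \<le> B u u * B v v"
  using assms comb nonneg quadratic[OF assms, symmetric]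
  by (intro discriminant_bound) auto

text \<open>
  The part of the Riesz representation theorem that holds without completeness. The functional
  \<open>B v v - 2 L v\<close> is bounded below; a sequence that minimises it fast is Cauchy by the
  parallelogram law, and it represents \<open>L\<close> in the limit. The two uses differ only in how a
  limit of the sequence is then found.
\<close>

lemma Riesz_minimizing_sequence:
  fixes L :: "('a \<Rightarrow> real) \<Rightarrow> real"
  assumes Llin: "\<And>u v c. u \<in> V \<Longrightarrow> v \<in> V \<Longrightarrow> L (\<lambda>x. u x + c * v x) = L u + c * L v"
    and Lbound: "\<And>u. u \<in> V \<Longrightarrow> (L u)\<^sup>2 \<le> K * B u u"
  obtains v where "\<And>j. v j \<in> V"
    and "\<And>i j. i \<le> j \<Longrightarrow> B (\<lambda>x. v j x - v i x) (\<lambda>x. v j x - v i x) \<le> 1 / 4 ^ i"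
    and "\<And>\<phi>. \<phi> \<in> V \<Longrightarrow> (\<lambda>j. B (v j) \<phi>) \<longlonglongrightarrow> L \<phi>"
proof -
  define J where "J u = B u u - 2 * L u" for u
  have J_ge: "- \<bar>K\<bar> \<le> J u" if "u \<in> V" for u
  proof -
    have "(2 * L u)\<^sup>2 \<le> 4 * \<bar>K\<bar> * B u u"
      using order_trans[OF Lbound[OF that] mult_right_mono[of K "\<bar>K\<bar>" "B u u"]] nonneg[OF that]
      by (simp add: power_mult_distrib)
    also have "\<dots> \<le> (B u u + \<bar>K\<bar>)\<^sup>2"
      using sum_squares_bound[of "B u u" "\<bar>K\<bar>"] by (simp add: power2_eq_square algebra_simps)
    finally have "\<bar>2 * L u\<bar> \<le> \<bar>B u u + \<bar>K\<bar>\<bar>"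
      by (simp only: abs_le_square_iff)
    then show ?thesis using nonneg[OF that] by (simp add: J_def)
  qed
  define m where "m = Inf (J ` V)"
  have bdd: "bdd_below (J ` V)"
    using J_ge by (intro bdd_belowI2)
  have m_le: "m \<le> J u" if "u \<in> V" for u
    unfolding m_def using bdd that by (intro cInf_lower) auto
  have ex: "\<exists>u\<in>V. J u < m + e" if "e > 0" for e
    using cInf_lessD[of "J ` V" "m + e"] nonempty that by (auto simp: m_def)
  define e :: "nat \<Rightarrow> real" where "e j = 1 / 4 ^ j / 4" for j
  have e: "e j > 0" for j by (simp add: e_def)
  have "\<forall>j. \<exists>u\<in>V. J u < m + e j" using ex e by blast
  then obtain v where v: "\<And>j. v j \<in> V" and Jv: "\<And>j. J (v j) < m + e j"
    by metis
  have Jquad: "J (\<lambda>x. u x + t * w x) = J u + 2 * t * (B u w - L w) + t\<^sup>2 * B w w"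
    if "u \<in> V" "w \<in> V" for u w t
    using that by (simp add: J_def quadratic Llin algebra_simps)
  \<comment> \<open>the midpoint of two near-minimisers cannot lie below the infimum\<close>
  have C1: "B (\<lambda>x. v j x - v i x) (\<lambda>x. v j x - v i x) \<le> 1 / 4 ^ i" if ij: "i \<le> j" for i j
  proof -
    have arith: "q \<le> 2 * ei + 2 * ej"
      if "m \<le> Ji + b + (1/4) * q" "Jj = Ji + 2 * b + q" "Ji < m + ei" "Jj < m + ej"
      for q b Ji Jj ei ej :: real
      using that by argo
    define d where "d = (\<lambda>x. v j x - v i x)"
    have d: "d \<in> V" using diff[OF v v] by (simp add: d_def)
    have "J (v j) = J (\<lambda>x. v i x + 1 * d x)" by (simp add: d_def)
    also have "\<dots> = J (v i) + 2 * (B (v i) d - L d) + B d d"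
      using Jquad[OF v d, of i 1] by simp
    finally have 1: "J (v j) = J (v i) + 2 * (B (v i) d - L d) + B d d" .
    have 2: "J (\<lambda>x. v i x + (1/2) * d x) = J (v i) + (B (v i) d - L d) + (1/4) * B d d"
      using Jquad[OF v d, of i "1/2"] by (simp add: power2_eq_square)
    have "m \<le> J (v i) + (B (v i) d - L d) + (1/4) * B d d"
      unfolding 2[symmetric] by (intro m_le comb v d)
    then have "B d d \<le> 2 * e i + 2 * e j"
      using 1 Jv[of i] Jv[of j] arith by blast
    moreover have "e j \<le> e i"
      unfolding e_def using ij by (intro divide_right_mono divide_left_mono power_increasing) auto
    ultimately show ?thesis by (simp add: e_def d_def)
  qed
  \<comment> \<open>perturbing a near-minimiser in the direction of the test function gains at most \<open>e j\<close>\<close>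
  have C2: "(\<lambda>j. B (v j) \<phi>) \<longlonglongrightarrow> L \<phi>" if \<phi>: "\<phi> \<in> V" for \<phi>
  proof -
    have "(B (v j) \<phi> - L \<phi>)\<^sup>2 \<le> e j * B \<phi> \<phi>" for j
    proof (rule discriminant_bound)
      show "0 \<le> B \<phi> \<phi>" by (rule nonneg[OF \<phi>])
      fix t
      have "m \<le> J (\<lambda>x. v j x + t * \<phi> x)"
        by (intro m_le comb v \<phi>)
      then show "0 \<le> e j + 2 * t * (B (v j) \<phi> - L \<phi>) + t\<^sup>2 * B \<phi> \<phi>"
        using Jquad[OF v \<phi>, of j t] Jv[of j] by linarith
    qed
    moreover have "(\<lambda>j. e j * B \<phi> \<phi>) \<longlonglongrightarrow> 0"
      using inverse_power4_tendsto_0[of "B \<phi> \<phi> / 4"] by (simp add: e_def field_simps)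
    ultimately have "(\<lambda>j. B (v j) \<phi> - L \<phi>) \<longlonglongrightarrow> 0"
      by (rule tendsto_0_if_square_le)
    then show ?thesis by (simp add: LIM_zero_iff)
  qed
  show ?thesis using that v C1 C2 by blast
qed

end

lemma nonneg_form_integral:
  "nonneg_form (square_integrable M) (\<lambda>u v. LINT x|M. u x * v x)"
proof
  show "square_integrable M \<noteq> {}"
    by (auto simp: square_integrable_def intro!: exI[of _ "\<lambda>_. 0"])
next
  fix u v w and c :: real
  assume *: "u \<in> square_integrable M" "v \<in> square_integrable M" "w \<in> square_integrable M"
  have "(LINT x|M. u x * w x + c * (v x * w x))
        = (LINT x|M. u x * w x) + c * (LINT x|M. v x * w x)"
    using square_integrable_mult[OF *(1,3)] square_integrable_mult[OF *(2,3)] by simp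
  then show "(LINT x|M. (u x + c * v x) * w x)
        = (LINT x|M. u x * w x) + c * (LINT x|M. v x * w x)"
    by (simp add: algebra_simps)
qed (auto simp: square_integrable_comb mult.commute)

lemmas integral_Cauchy_Schwarz = nonneg_form.Cauchy_Schwarz[OF nonneg_form_integral]

lemma square_integrable_Riesz:
  fixes L :: "('a \<Rightarrow> real) \<Rightarrow> real"
  assumes Llin: "\<And>u v c. u \<in> square_integrable M \<Longrightarrow> v \<in> square_integrable M \<Longrightarrow>
              L (\<lambda>x. u x + c * v x) = L u + c * L v"
    and Lbound: "\<And>u. u \<in> square_integrable M \<Longrightarrow> (L u)\<^sup>2 \<le> K * (LINT x|M. (u x)\<^sup>2)"
  obtains u where "u \<in> square_integrable M"
    and "\<And>\<phi>. \<phi> \<in> square_integrable M \<Longrightarrow> L \<phi> = (LINT x|M. u x * \<phi> x)"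
proof -
  interpret nonneg_form "square_integrable M" "\<lambda>u v. LINT x|M. u x * v x"
    by (rule nonneg_form_integral)
  obtain v where v: "\<And>j. v j \<in> square_integrable M"
    and fast: "\<And>i j. i \<le> j \<Longrightarrow> (LINT x|M. (v j x - v i x) * (v j x - v i x)) \<le> 1 / 4 ^ i"
    and lim: "\<And>\<phi>. \<phi> \<in> square_integrable M \<Longrightarrow> (\<lambda>j. LINT x|M. v j x * \<phi> x) \<longlonglongrightarrow> L \<phi>"
    using Riesz_minimizing_sequence[of L K] Llin Lbound by (auto simp: power2_eq_square)
  have fast': "(LINT x|M. (v j x - v i x)\<^sup>2) \<le> 1 / 4 ^ i" if "i \<le> j" for i j
    using fast[OF that] by (simp add: power2_eq_square)
  obtain u where u: "u \<in> square_integrable M"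
    and ui: "\<And>i. (LINT x|M. (u x - v i x)\<^sup>2) \<le> 1 / 4 ^ i"
    using square_integrable_Cauchy_limit[OF v fast'] by blast
  show ?thesis
  proof (rule that[OF u])
    fix \<phi> assume \<phi>: "\<phi> \<in> square_integrable M"
    have "((LINT x|M. u x * \<phi> x) - (LINT x|M. v j x * \<phi> x))\<^sup>2
        \<le> 1 / 4 ^ j * (LINT x|M. (\<phi> x)\<^sup>2)" for j
    proof -
      have "((LINT x|M. u x * \<phi> x) - (LINT x|M. v j x * \<phi> x))\<^sup>2 = (LINT x|M. (u x - v j x) * \<phi> x)\<^sup>2"
        using lin_diff[OF u v \<phi>] by simp
      also have "\<dots> \<le> (LINT x|M. (u x - v j x)\<^sup>2) * (LINT x|M. (\<phi> x)\<^sup>2)"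
        using Cauchy_Schwarz[OF diff[OF u v] \<phi>] by (simp add: power2_eq_square)
      also have "\<dots> \<le> 1 / 4 ^ j * (LINT x|M. (\<phi> x)\<^sup>2)"
        by (intro mult_right_mono ui) simp
      finally show ?thesis .
    qed
    moreover have "(\<lambda>j. 1 / 4 ^ j * (LINT x|M. (\<phi> x)\<^sup>2)) \<longlonglongrightarrow> 0"
      by (rule inverse_power4_tendsto_0)
    ultimately have "(\<lambda>j. (LINT x|M. u x * \<phi> x) - (LINT x|M. v j x * \<phi> x)) \<longlonglongrightarrow> 0"
      by (rule tendsto_0_if_square_le)
    moreover have "(\<lambda>j. (LINT x|M. u x * \<phi> x) - (LINT x|M. v j x * \<phi> x))
        \<longlonglongrightarrow> (LINT x|M. u x * \<phi> x) - L \<phi>"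
      by (rule tendsto_diff[OF tendsto_const lim[OF \<phi>]])
    ultimately show "L \<phi> = (LINT x|M. u x * \<phi> x)"
      using LIMSEQ_unique by fastforce
  qed
qed

section \<open>Weak cluster points\<close>

text \<open>
  In a compact space without countable bases a sequence has no convergent subsequence in general, but it
  converges along a finer filter: the one generated by the times at which it visits the
  neighbourhoods of a cluster point.
\<close>

lemma compact_sequence_cluster_filter:
  fixes f :: "nat \<Rightarrow> 'b::topological_space"
  assumes "compact K" "\<And>j. f j \<in> K"
  obtains F x where "F \<noteq> bot" "F \<le> sequentially" "x \<in> K" "(f \<longlongrightarrow> x) F"
proof -
  obtain x where x: "x \<in> K" "inf (nhds x) (filtermap f sequentially) \<noteq> bot"
    using assms(1)[unfolded compact_filter, rule_format, of "filtermap f sequentially"] assms(2)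
    by (auto simp: filtermap_bot_iff eventually_filtermap)
  define F where "F = inf (filtercomap f (nhds x)) sequentially"
  have "F \<noteq> bot"
  proof
    assume "F = bot"
    then have "eventually (\<lambda>_. False) F" by simp
    then obtain P Q where P: "eventually P (filtercomap f (nhds x))"
      and Q: "eventually Q sequentially" and PQ: "\<And>j. P j \<Longrightarrow> Q j \<Longrightarrow> False"
      unfolding F_def eventually_inf by blast
    from P obtain P' where P': "eventually P' (nhds x)" "\<And>j. P' (f j) \<Longrightarrow> P j"
      unfolding eventually_filtercomap by blast
    have "eventually (\<lambda>y. \<not> P' y) (filtermap f sequentially)"
      unfolding eventually_filtermap using Q by eventually_elim (use P' PQ in blast)
    with P'(1) have "eventually (\<lambda>_. False) (inf (nhds x) (filtermap f sequentially))"
      unfolding eventually_inf by blast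
    with x(2) show False by (simp add: trivial_limit_def)
  qed
  moreover have "F \<le> sequentially" by (simp add: F_def)
  moreover have "(f \<longlongrightarrow> x) F"
    unfolding filterlim_iff_le_filtercomap F_def by simp
  ultimately show ?thesis using that x(1) by blast
qed

lemma compact_PiE_UNIV:
  fixes S :: "'i \<Rightarrow> 'b::topological_space set"
  assumes "\<And>i. compact (S i)"
  shows "compact (PiE UNIV S)"
proof -
  have "compactin (product_topology (\<lambda>_. euclidean) UNIV) (PiE UNIV S)"
    using assms by (simp add: compactin_PiE compactin_euclidean_iff)
  then show ?thesis
    by (simp add: euclidean_product_topology compactin_euclidean_iff)
qed

text \<open>
  The functionals \<open>g \<mapsto> \<integral> \<eta>\<^sub>j g\<close> lie in a product of compact intervals, which is compact by Tychonoff's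
  theorem. A cluster point in this product is again linear and bounded, so it is represented by a
  function. The limit is taken along a filter instead of a subsequence, and this costs nothing as long as
  only inequalities and limits of numbers are passed to it.
\<close>

lemma square_integrable_weak_cluster_point:
  fixes \<eta> :: "nat \<Rightarrow> 'a \<Rightarrow> real"
  assumes \<eta>: "\<And>j. \<eta> j \<in> square_integrable M"
    and C: "\<And>j. (LINT x|M. (\<eta> j x)\<^sup>2) \<le> C"
  obtains F \<eta>\<^sub>0 where "F \<noteq> bot" "F \<le> sequentially" "\<eta>\<^sub>0 \<in> square_integrable M"
    and "\<And>g. g \<in> square_integrable M \<Longrightarrow>
           ((\<lambda>j. LINT x|M. \<eta> j x * g x) \<longlongrightarrow> (LINT x|M. \<eta>\<^sub>0 x * g x)) F"
proof -
  define ev where "ev j g = (if g \<in> square_integrable M then LINT x|M. \<eta> j x * g x else 0)" for j g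
  define r where "r g = sqrt (C * (LINT x|M. (g x)\<^sup>2))" for g
  have sq: "(LINT x|M. \<eta> j x * g x)\<^sup>2 \<le> C * (LINT x|M. (g x)\<^sup>2)"
    if "g \<in> square_integrable M" for j g
  proof -
    have "(LINT x|M. \<eta> j x * g x)\<^sup>2 \<le> (LINT x|M. (\<eta> j x)\<^sup>2) * (LINT x|M. (g x)\<^sup>2)"
      using integral_Cauchy_Schwarz[OF \<eta> that] by (simp add: power2_eq_square)
    also have "\<dots> \<le> C * (LINT x|M. (g x)\<^sup>2)"
      by (intro mult_right_mono C) simp
    finally show ?thesis .
  qed
  have C0: "0 \<le> C"
    by (rule order_trans[OF _ C[of 0]]) simp
  have "\<bar>ev j g\<bar> \<le> r g" for j g
    using sq[of g j] C0 by (auto simp: ev_def r_def intro!: real_le_rsqrt)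
  then have "ev j \<in> PiE UNIV (\<lambda>g. {- r g..r g})" for j
    by (auto simp: abs_le_iff minus_le_iff)
  then obtain F L where F: "F \<noteq> bot" "F \<le> sequentially" and L: "(ev \<longlongrightarrow> L) F"
    by (rule compact_sequence_cluster_filter[OF compact_PiE_UNIV[OF compact_Icc]])
  have evL: "((\<lambda>j. ev j g) \<longlongrightarrow> L g) F" for g
    using continuous_on_tendsto_compose[OF continuous_on_product_coordinates[of g] L] by simp
  have lim: "((\<lambda>j. LINT x|M. \<eta> j x * g x) \<longlongrightarrow> L g) F" if "g \<in> square_integrable M" for g
    using evL[of g] that by (simp add: ev_def)
  interpret nonneg_form "square_integrable M" "\<lambda>u v. LINT x|M. u x * v x"
    by (rule nonneg_form_integral)
  obtain \<eta>\<^sub>0 where "\<eta>\<^sub>0 \<in> square_integrable M"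
    and rep: "\<And>g. g \<in> square_integrable M \<Longrightarrow> L g = (LINT x|M. \<eta>\<^sub>0 x * g x)"
  proof (rule square_integrable_Riesz[where L = L and M = M and K = C])
    fix u v :: "'a \<Rightarrow> real" and c :: real
    assume uv: "u \<in> square_integrable M" "v \<in> square_integrable M"
    have "((\<lambda>j. (LINT x|M. \<eta> j x * u x) + c * (LINT x|M. \<eta> j x * v x)) \<longlongrightarrow> L u + c * L v) F"
      by (intro tendsto_intros lim uv)
    moreover have "(LINT x|M. \<eta> j x * u x) + c * (LINT x|M. \<eta> j x * v x)
        = (LINT x|M. \<eta> j x * (u x + c * v x))" for j
      using lin[OF uv \<eta>[of j], of c] by (simp add: mult.commute)
    ultimately show "L (\<lambda>x. u x + c * v x) = L u + c * L v"
      using tendsto_unique[OF F(1) lim[OF comb[OF uv, of c]]] by simp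
  next
    fix u assume u: "u \<in> square_integrable M"
    show "(L u)\<^sup>2 \<le> C * (LINT x|M. (u x)\<^sup>2)"
      by (rule tendsto_upperbound[OF tendsto_power[OF lim[OF u]]]) (simp_all add: sq u F)
  qed auto
  then show ?thesis
    using that[OF F] lim by simp
qed

lemma square_integrable_bounded:
  assumes "finite_measure M" "u \<in> borel_measurable M" "\<And>x. x \<in> space M \<Longrightarrow> \<bar>u x\<bar> \<le> b"
  shows "u \<in> square_integrable M"
proof -
  interpret finite_measure M by fact
  have "integrable M (\<lambda>x. (u x)\<^sup>2)"
  proof (rule integrable_const_bound[where B = "b\<^sup>2"])
    show "AE x in M. norm ((u x)\<^sup>2) \<le> b\<^sup>2"
      using power_mono[OF assms(3) abs_ge_zero, of _ 2] by (intro AE_I2) simp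
  qed (use assms in simp)
  then show ?thesis using assms by (simp add: square_integrable_def)
qed

text \<open>
  Pointwise bounds survive weak limits: testing with the indicator of the set where the limit violates
  the bound shows that this set is null.
\<close>

lemma weak_limit_ge:
  fixes \<eta> :: "nat \<Rightarrow> 'a \<Rightarrow> real"
  assumes M: "finite_measure M" and F: "F \<noteq> bot"
    and \<eta>: "\<And>j. \<eta> j \<in> square_integrable M" "\<eta>\<^sub>0 \<in> square_integrable M"
    and lim: "\<And>g. g \<in> square_integrable M \<Longrightarrow>
           ((\<lambda>j. LINT x|M. \<eta> j x * g x) \<longlongrightarrow> (LINT x|M. \<eta>\<^sub>0 x * g x)) F"
    and ge: "\<And>j x. x \<in> space M \<Longrightarrow> a \<le> \<eta> j x"
  shows "AE x in M. a \<le> \<eta>\<^sub>0 x"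
proof -
  interpret finite_measure M by fact
  have [measurable]: "\<eta>\<^sub>0 \<in> borel_measurable M"
    using \<eta> by (simp add: square_integrable_def)
  define g :: "'a \<Rightarrow> real" where "g x = (if \<eta>\<^sub>0 x < a then 1 else 0)" for x
  have [measurable]: "g \<in> borel_measurable M" unfolding g_def by measurable
  have g: "g \<in> square_integrable M"
    by (rule square_integrable_bounded[OF M, where b = 1]) (auto simp: g_def)
  have gi: "integrable M g"
    by (rule integrable_const_bound[where B = 1]) (auto simp: g_def)
  have "a * (LINT x|M. g x) \<le> (LINT x|M. \<eta>\<^sub>0 x * g x)"
  proof (rule tendsto_lowerbound[OF lim[OF g]])
    show "\<forall>\<^sub>F j in F. a * (LINT x|M. g x) \<le> (LINT x|M. \<eta> j x * g x)"
    proof (intro always_eventually allI)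
      fix j
      have "(LINT x|M. a * g x) \<le> (LINT x|M. \<eta> j x * g x)"
      proof (rule integral_mono)
        show "integrable M (\<lambda>x. a * g x)" using gi by simp
        show "integrable M (\<lambda>x. \<eta> j x * g x)" by (rule square_integrable_mult[OF \<eta>(1) g])
      qed (use ge in \<open>auto simp: g_def\<close>)
      then show "a * (LINT x|M. g x) \<le> (LINT x|M. \<eta> j x * g x)" by simp
    qed
  qed (rule F)
  moreover have i: "integrable M (\<lambda>x. a * g x - \<eta>\<^sub>0 x * g x)"
    using square_integrable_mult[OF \<eta>(2) g] gi by auto
  moreover have "(LINT x|M. a * g x - \<eta>\<^sub>0 x * g x) = a * (LINT x|M. g x) - (LINT x|M. \<eta>\<^sub>0 x * g x)"
    using square_integrable_mult[OF \<eta>(2) g] gi by simp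
  moreover have nn: "AE x in M. 0 \<le> a * g x - \<eta>\<^sub>0 x * g x"
    by (intro AE_I2) (auto simp: g_def)
  ultimately have "(LINT x|M. a * g x - \<eta>\<^sub>0 x * g x) = 0"
    using integral_nonneg_AE[OF nn] by simp
  then have "AE x in M. a * g x - \<eta>\<^sub>0 x * g x = 0"
    using integral_nonneg_eq_0_iff_AE[OF i nn] by simp
  then show ?thesis
    by eventually_elim (auto simp: g_def split: if_splits)
qed

lemma weak_limit_le:
  fixes \<eta> :: "nat \<Rightarrow> 'a \<Rightarrow> real"
  assumes M: "finite_measure M" and F: "F \<noteq> bot"
    and \<eta>: "\<And>j. \<eta> j \<in> square_integrable M" "\<eta>\<^sub>0 \<in> square_integrable M"
    and lim: "\<And>g. g \<in> square_integrable M \<Longrightarrow>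
           ((\<lambda>j. LINT x|M. \<eta> j x * g x) \<longlongrightarrow> (LINT x|M. \<eta>\<^sub>0 x * g x)) F"
    and le: "\<And>j x. x \<in> space M \<Longrightarrow> \<eta> j x \<le> b"
  shows "AE x in M. \<eta>\<^sub>0 x \<le> b"
proof -
  have "AE x in M. - b \<le> - \<eta>\<^sub>0 x"
  proof (rule weak_limit_ge[OF M F, where \<eta> = "\<lambda>j x. - \<eta> j x"])
    show "(\<lambda>x. - \<eta> j x) \<in> square_integrable M" for j
      using \<eta>(1)[of j] by (simp add: square_integrable_def)
    show "(\<lambda>x. - \<eta>\<^sub>0 x) \<in> square_integrable M"
      using \<eta>(2) by (simp add: square_integrable_def)
    show "((\<lambda>j. LINT x|M. - \<eta> j x * g x) \<longlongrightarrow> (LINT x|M. - \<eta>\<^sub>0 x * g x)) F"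
      if "g \<in> square_integrable M" for g
      using tendsto_minus[OF lim[OF that]] by simp
  qed (use le in auto)
  then show ?thesis by simp
qed

lemma powr_above_tangent:
  fixes s t r :: real
  assumes "0 < s" "0 < t" "1 \<le> r"
  shows "s powr r + r * s powr (r - 1) * (t - s) \<le> t powr r"
proof -
  have "t powr r - s powr r \<ge> r * s powr (r - 1) * (t - s)"
    using assms
    by (intro convex_on_imp_above_tangent[where A = "{0<..}"] powr_convex)
       (auto intro!: derivative_eq_intros simp: interior_open)
  then show ?thesis by simp
qed

text \<open>
  Convex integral functionals are weakly lower semicontinuous. The graph of \<open>t powr r\<close> lies above its
  tangent at \<open>\<eta>\<^sub>0 x\<close>, and the tangent is affine in \<open>\<eta> j x\<close> with bounded slope \<open>r * \<eta>\<^sub>0 x powr (r - 1)\<close>, so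
  its integral converges.
\<close>

lemma weak_limit_integral_powr_le:
  fixes \<eta> :: "nat \<Rightarrow> 'a \<Rightarrow> real"
  assumes M: "finite_measure M" and F: "F \<noteq> bot"
    and \<eta>: "\<And>j. \<eta> j \<in> borel_measurable M" "\<eta>\<^sub>0 \<in> borel_measurable M"
    and bounds: "0 < a" "\<And>j x. a \<le> \<eta> j x" "\<And>j x. \<eta> j x \<le> b" "\<And>x. a \<le> \<eta>\<^sub>0 x" "\<And>x. \<eta>\<^sub>0 x \<le> b"
    and lim: "\<And>g. g \<in> square_integrable M \<Longrightarrow>
           ((\<lambda>j. LINT x|M. \<eta> j x * g x) \<longlongrightarrow> (LINT x|M. \<eta>\<^sub>0 x * g x)) F"
    and r: "1 \<le> r" and S: "S \<in> sets M"
    and le: "\<And>j. (LINT x|M. indicator S x * \<eta> j x powr r) \<le> c"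
  shows "(LINT x|M. indicator S x * \<eta>\<^sub>0 x powr r) \<le> c"
proof -
  interpret finite_measure M by fact
  note [measurable] = \<eta> S
  define g where "g x = indicator S x * (r * \<eta>\<^sub>0 x powr (r - 1))" for x
  have [measurable]: "g \<in> borel_measurable M" unfolding g_def by measurable
  have b: "0 < b" using bounds(1,4,5) by (meson less_le_trans)
  have pos: "0 < \<eta> j x" "0 < \<eta>\<^sub>0 x" for j x
    using bounds by (meson less_le_trans)+
  have g: "g \<in> square_integrable M"
  proof (rule square_integrable_bounded[OF M, where b = "r * b powr (r - 1)"])
    fix x
    have "\<eta>\<^sub>0 x powr (r - 1) \<le> b powr (r - 1)"
      using bounds pos(2)[of x] r by (intro powr_mono2) auto
    then show "\<bar>g x\<bar> \<le> r * b powr (r - 1)"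
      using r by (auto simp: g_def indicator_def abs_mult)
  qed simp
  have pi: "integrable M (\<lambda>x. indicator S x * h x powr r)"
    if [measurable]: "h \<in> borel_measurable M" and h: "\<And>x. a \<le> h x" "\<And>x. h x \<le> b" for h
  proof (rule integrable_const_bound[where B = "b powr r"])
    have "h x powr r \<le> b powr r" for x
      using h[of x] bounds(1) r by (intro powr_mono2) auto
    then show "AE x in M. norm (indicator S x * h x powr r) \<le> b powr r"
      by (intro AE_I2) (auto simp: indicator_def)
  qed simp
  have sq: "h \<in> square_integrable M"
    if [measurable]: "h \<in> borel_measurable M" and h: "\<And>x. a \<le> h x" "\<And>x. h x \<le> b" for h
  proof (rule square_integrable_bounded[OF M, where b = b])
    show "\<bar>h x\<bar> \<le> b" for x using h[of x] bounds(1) by linarith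
  qed fact
  note i1 = pi[OF \<eta>(1) bounds(2,3)] and i0 = pi[OF \<eta>(2) bounds(4,5)]
  note j1 = square_integrable_mult[OF sq[OF \<eta>(1) bounds(2,3)] g]
   and j0 = square_integrable_mult[OF sq[OF \<eta>(2) bounds(4,5)] g]
  have "(LINT x|M. indicator S x * \<eta>\<^sub>0 x powr r) + ((LINT x|M. \<eta> j x * g x) - (LINT x|M. \<eta>\<^sub>0 x * g x)) \<le> c"
    for j
  proof -
    have "(LINT x|M. indicator S x * \<eta>\<^sub>0 x powr r) + ((LINT x|M. \<eta> j x * g x) - (LINT x|M. \<eta>\<^sub>0 x * g x))
        = (LINT x|M. indicator S x * \<eta>\<^sub>0 x powr r + (\<eta> j x * g x - \<eta>\<^sub>0 x * g x))"
      using i0 j1 j0 by simp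
    also have "\<dots> \<le> (LINT x|M. indicator S x * \<eta> j x powr r)"
    proof (rule integral_mono)
      show "integrable M (\<lambda>x. indicator S x * \<eta>\<^sub>0 x powr r + (\<eta> j x * g x - \<eta>\<^sub>0 x * g x))"
        using i0 j1 j0 by simp
      fix x
      show "indicator S x * \<eta>\<^sub>0 x powr r + (\<eta> j x * g x - \<eta>\<^sub>0 x * g x) \<le> indicator S x * \<eta> j x powr r"
        using powr_above_tangent[OF pos(2) pos(1) r, of x j x]
        by (auto simp: g_def indicator_def algebra_simps)
    qed (rule i1)
    also have "\<dots> \<le> c" by (rule le)
    finally show ?thesis .
  qed
  moreover have "((\<lambda>j. (LINT x|M. indicator S x * \<eta>\<^sub>0 x powr r)
        + ((LINT x|M. \<eta> j x * g x) - (LINT x|M. \<eta>\<^sub>0 x * g x)))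
      \<longlongrightarrow> (LINT x|M. indicator S x * \<eta>\<^sub>0 x powr r)
        + ((LINT x|M. \<eta>\<^sub>0 x * g x) - (LINT x|M. \<eta>\<^sub>0 x * g x))) F"
    by (intro tendsto_add tendsto_diff tendsto_const lim g)
  ultimately show ?thesis
    using tendsto_upperbound[OF _ always_eventually F] by fastforce
qed

text \<open>
  Weak convergence of bounded functions implies that of their tensor squares. On rectangles the integral
  factorises. The sets for which convergence holds form a Dynkin system, and the admissible test
  functions are closed under dominated limits because the products are uniformly bounded by \<open>b\<^sup>2\<close>.
  Fubini and dominated convergence in the outer variable would be a shorter way for sequences, but
  dominated convergence fails along general filters.
\<close>

lemma weak_limit_tensor:
  fixes \<eta> :: "nat \<Rightarrow> 'a \<Rightarrow> real" and w :: "'a \<times> 'a \<Rightarrow> real"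
  assumes M: "finite_measure M"
    and \<eta>: "\<And>j. \<eta> j \<in> borel_measurable M" "\<eta>\<^sub>0 \<in> borel_measurable M"
    and bounds: "\<And>j x. \<bar>\<eta> j x\<bar> \<le> b" "\<And>x. \<bar>\<eta>\<^sub>0 x\<bar> \<le> b"
    and lim: "\<And>g. g \<in> square_integrable M \<Longrightarrow>
           ((\<lambda>j. LINT x|M. \<eta> j x * g x) \<longlongrightarrow> (LINT x|M. \<eta>\<^sub>0 x * g x)) F"
    and w: "integrable (M \<Otimes>\<^sub>M M) w"
  shows "((\<lambda>j. LINT z|(M \<Otimes>\<^sub>M M). \<eta> j (fst z) * \<eta> j (snd z) * w z)
    \<longlongrightarrow> (LINT z|(M \<Otimes>\<^sub>M M). \<eta>\<^sub>0 (fst z) * \<eta>\<^sub>0 (snd z) * w z)) F"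
proof -
  interpret finite_measure M by fact
  interpret P: pair_sigma_finite M M ..
  interpret N: finite_measure "M \<Otimes>\<^sub>M M"
    by (rule finite_measure_pair_measure) (unfold_locales)
  let ?N = "M \<Otimes>\<^sub>M M"
  note [measurable] = \<eta>
  define k where "k h w z = h (fst z) * h (snd z) * w z" for h :: "'a \<Rightarrow> real" and w z
  define Q where "Q w \<longleftrightarrow> ((\<lambda>j. LINT z|?N. k (\<eta> j) w z) \<longlongrightarrow> (LINT z|?N. k \<eta>\<^sub>0 w z)) F" for w
  have k_le: "\<bar>k h w z\<bar> \<le> b\<^sup>2 * \<bar>w z\<bar>" if "\<And>x. \<bar>h x\<bar> \<le> b" for h w z
  proof -
    have "\<bar>h (fst z)\<bar> * \<bar>h (snd z)\<bar> \<le> b * b"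
      using that order_trans[OF abs_ge_zero that] by (intro mult_mono) auto
    then have "\<bar>h (fst z)\<bar> * \<bar>h (snd z)\<bar> * \<bar>w z\<bar> \<le> b * b * \<bar>w z\<bar>"
      by (rule mult_right_mono) simp
    then show ?thesis by (simp add: k_def abs_mult power2_eq_square)
  qed
  have k_int: "integrable ?N (k h w)"
    if "integrable ?N w" "h \<in> borel_measurable M" "\<And>x. \<bar>h x\<bar> \<le> b" for h w
  proof (rule Bochner_Integration.integrable_bound)
    show "integrable ?N (\<lambda>z. b\<^sup>2 * w z)" using that by simp
    note [measurable] = that(2) borel_measurable_integrable[OF that(1)]
    show "k h w \<in> borel_measurable ?N" unfolding k_def by measurable
    show "AE z in ?N. norm (k h w z) \<le> norm (b\<^sup>2 * w z)"
      using k_le[OF that(3)] by (intro AE_I2) (simp add: abs_mult)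
  qed
  have k_diff: "\<bar>(LINT z|?N. k h w z) - (LINT z|?N. k h w' z)\<bar> \<le> b\<^sup>2 * (LINT z|?N. \<bar>w z - w' z\<bar>)"
    if h: "h \<in> borel_measurable M" "\<And>x. \<bar>h x\<bar> \<le> b" and w: "integrable ?N w" "integrable ?N w'" for h w w'
  proof -
    have "(LINT z|?N. k h w z) - (LINT z|?N. k h w' z) = (LINT z|?N. k h (\<lambda>z. w z - w' z) z)"
      unfolding Bochner_Integration.integral_diff[OF k_int[OF w(1) h] k_int[OF w(2) h], symmetric]
      by (simp add: k_def right_diff_distrib)
    also have "\<bar>\<dots>\<bar> \<le> (LINT z|?N. b\<^sup>2 * \<bar>w z - w' z\<bar>)"
    proof -
      have "norm (LINT z|?N. k h (\<lambda>z. w z - w' z) z) \<le> (LINT z|?N. b\<^sup>2 * \<bar>w z - w' z\<bar>)"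
      proof (rule order_trans[OF Bochner_Integration.integral_norm_bound integral_mono])
        show "integrable ?N (\<lambda>z. norm (k h (\<lambda>z. w z - w' z) z))"
          using w h by (intro integrable_norm k_int) auto
        show "integrable ?N (\<lambda>z. b\<^sup>2 * \<bar>w z - w' z\<bar>)" using w by auto
        show "norm (k h (\<lambda>z. w z - w' z) z) \<le> b\<^sup>2 * \<bar>w z - w' z\<bar>" for z
          using k_le[of h "\<lambda>z. w z - w' z" z] h(2) by simp
      qed
      then show ?thesis by simp
    qed
    finally show ?thesis by simp
  qed
  \<comment> \<open>an \<open>\<epsilon>/3\<close> argument; dominated convergence is applied only to the sequence of test functions\<close>
  have closed: "Q w"
    if s: "\<And>i. integrable ?N (s i)" "\<And>i. Q (s i)" and lm: "\<And>z. z \<in> space ?N \<Longrightarrow> (\<lambda>i. s i z) \<longlonglongrightarrow> w z"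
      and g: "integrable ?N g" "\<And>i z. z \<in> space ?N \<Longrightarrow> \<bar>s i z\<bar> \<le> g z" and w: "integrable ?N w"
    for s :: "nat \<Rightarrow> _" and w g
  proof -
    note [measurable] = borel_measurable_integrable[OF s(1)] borel_measurable_integrable[OF w]
    have "(\<lambda>i. LINT z|?N. \<bar>w z - s i z\<bar>) \<longlonglongrightarrow> (LINT z|?N. 0)"
    proof (rule integral_dominated_convergence)
      show "integrable ?N (\<lambda>z. \<bar>w z\<bar> + g z)" using w g by auto
      show "AE z in ?N. (\<lambda>i. \<bar>w z - s i z\<bar>) \<longlonglongrightarrow> 0"
      proof (rule AE_I2)
        fix z assume "z \<in> space ?N"
        from tendsto_rabs[OF tendsto_diff[OF tendsto_const lm[OF this]], of "w z"]
        show "(\<lambda>i. \<bar>w z - s i z\<bar>) \<longlonglongrightarrow> 0" by simp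
      qed
      show "AE z in ?N. norm \<bar>w z - s i z\<bar> \<le> \<bar>w z\<bar> + g z" for i
      proof (rule AE_I2)
        fix z assume "z \<in> space ?N"
        from g(2)[OF this, of i] show "norm \<bar>w z - s i z\<bar> \<le> \<bar>w z\<bar> + g z" by simp
      qed
    qed simp_all
    from tendsto_mult_right_zero[OF this[simplified], of "b\<^sup>2"]
    have small: "(\<lambda>i. b\<^sup>2 * (LINT z|?N. \<bar>w z - s i z\<bar>)) \<longlonglongrightarrow> 0" .
    show "Q w" unfolding Q_def
    proof (rule tendstoI)
      fix e :: real assume e: "0 < e"
      obtain i where i: "b\<^sup>2 * (LINT z|?N. \<bar>w z - s i z\<bar>) < e / 3"
        using order_tendstoD(2)[OF small, of "e / 3"] e by (auto simp: eventually_sequentially)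
      have "\<forall>\<^sub>F j in F. dist (LINT z|?N. k (\<eta> j) (s i) z) (LINT z|?N. k \<eta>\<^sub>0 (s i) z) < e / 3"
        using s(2)[of i] e unfolding Q_def by (intro tendstoD) auto
      then show "\<forall>\<^sub>F j in F. dist (LINT z|?N. k (\<eta> j) w z) (LINT z|?N. k \<eta>\<^sub>0 w z) < e"
      proof eventually_elim
        case (elim j)
        with i k_diff[OF \<eta>(1) bounds(1) w s(1), of j i] k_diff[OF \<eta>(2) bounds(2) w s(1), of i]
        show ?case unfolding dist_real_def by linarith
      qed
    qed
  qed
  have rect: "Q (indicator (X \<times> Y))" if XY: "X \<in> sets M" "Y \<in> sets M" for X Y
  proof -
    have fub: "(LINT z|?N. k h (indicator (X \<times> Y)) z) = (LINT x|M. h x * indicator X x) * (LINT x|M. h x * indicator Y x)"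
      if h: "h \<in> borel_measurable M" "\<And>x. \<bar>h x\<bar> \<le> b" for h
    proof -
      have int: "integrable ?N (k h (indicator (X \<times> Y)))"
        using XY h by (intro k_int) (auto simp: N.emeasure_eq_measure)
      have "(LINT z|?N. k h (indicator (X \<times> Y)) z) = (LINT x|M. (LINT y|M. k h (indicator (X \<times> Y)) (x, y)))"
        using P.integral_fst'[OF int] by simp
      also have "\<dots> = (LINT x|M. (LINT y|M. (h x * indicator X x) * (h y * indicator Y y)))"
        by (intro Bochner_Integration.integral_cong refl) (auto simp: k_def indicator_def)
      finally show ?thesis by simp
    qed
    have ind: "indicator X \<in> square_integrable M" if "X \<in> sets M" for X
      using that by (intro square_integrable_bounded[OF M, where b = 1]) (auto simp: indicator_def)
    show ?thesis
      unfolding Q_def fub[OF \<eta>(1) bounds(1)] fub[OF \<eta>(2) bounds(2)]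
      by (intro tendsto_mult lim ind XY)
  qed
  have ind: "Q (indicator S)" if S: "S \<in> sets ?N" for S
  proof -
    have sub: "{a \<times> b |a b. a \<in> sets M \<and> b \<in> sets M} \<subseteq> Pow (space M \<times> space M)"
      by (auto dest: sets.sets_into_space)
    from S[unfolded sets_pair_measure] show ?thesis
    proof (induction rule: sigma_sets_induct_disjoint[OF Int_stable_pair_measure_generator sub, consumes 1])
      case (1 A) then show ?case using rect by auto
    next
      case 2 then show ?case by (simp add: Q_def k_def)
    next
      case (3 A)
      have A: "A \<in> sets ?N" using 3 by (simp add: sets_pair_measure)
      have "(LINT z|?N. k h (indicator (space M \<times> space M - A)) z)
          = (LINT z|?N. k h (indicator (space M \<times> space M)) z) - (LINT z|?N. k h (indicator A) z)"
        if h: "h \<in> borel_measurable M" "\<And>x. \<bar>h x\<bar> \<le> b" for h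
      proof -
        have "(LINT z|?N. k h (indicator (space M \<times> space M)) z) - (LINT z|?N. k h (indicator A) z)
           = (LINT z|?N. k h (indicator (space M \<times> space M)) z - k h (indicator A) z)"
          using A h by (intro Bochner_Integration.integral_diff[symmetric] k_int)
            (auto simp: N.emeasure_eq_measure)
        also have "\<dots> = (LINT z|?N. k h (indicator (space M \<times> space M - A)) z)"
          using sets.sets_into_space[OF A]
          by (intro Bochner_Integration.integral_cong refl)
             (auto simp: k_def indicator_def space_pair_measure)
        finally show ?thesis by simp
      qed
      from this[OF \<eta>(1) bounds(1)] this[OF \<eta>(2) bounds(2)]
      show ?case
        unfolding Q_def using 3 rect[OF sets.top sets.top] unfolding Q_def
        by (simp add: tendsto_diff)
    next
      case (4 A)
      have A: "A i \<in> sets ?N" for i using 4 by (auto simp: sets_pair_measure)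
      define s where "s n z = (\<Sum>i<n. indicator (A i) z :: real)" for n z
      have s_eq: "s n = indicator (\<Union>i<n. A i)" for n
        unfolding s_def using 4(1)
        by (intro ext indicator_UN_disjoint[symmetric]) (auto simp: disjoint_family_on_def)
      have ii: "integrable ?N (indicator (A i) :: _ \<Rightarrow> real)" for i
        using A by (auto simp: N.emeasure_eq_measure)
      have Qs: "Q (s n)" for n
      proof -
        have "(LINT z|?N. k h (s n) z) = (\<Sum>i<n. LINT z|?N. k h (indicator (A i)) z)"
          if h: "h \<in> borel_measurable M" "\<And>x. \<bar>h x\<bar> \<le> b" for h
        proof -
          have "(LINT z|?N. k h (s n) z) = (LINT z|?N. (\<Sum>i<n. k h (indicator (A i)) z))"
            by (simp add: s_def k_def sum_distrib_left)
          also have "\<dots> = (\<Sum>i<n. LINT z|?N. k h (indicator (A i)) z)"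
            by (intro Bochner_Integration.integral_sum k_int ii h)
          finally show ?thesis .
        qed
        from this[OF \<eta>(1) bounds(1)] this[OF \<eta>(2) bounds(2)] show ?thesis
          unfolding Q_def using 4 unfolding Q_def by (simp add: tendsto_sum)
      qed
      show ?case
      proof (rule closed[where s = s and g = "\<lambda>_. 1"])
        show "integrable ?N (s n)" for n unfolding s_def using ii by auto
        show "(\<lambda>n. s n z) \<longlonglongrightarrow> indicator (\<Union> (range A)) z" for z
          unfolding s_eq by (rule LIMSEQ_indicator_UN)
        show "integrable ?N (indicator (\<Union> (range A)) :: _ \<Rightarrow> real)"
          using A by (auto simp: N.emeasure_eq_measure)
      qed (use Qs in \<open>auto simp: s_eq indicator_def\<close>)
    qed
  qed
  have "Q w" using w
  proof (induction rule: integrable_induct)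
    case (base A c)
    have "(LINT z|?N. k h (\<lambda>z. indicator A z *\<^sub>R c) z) = (LINT z|?N. k h (indicator A) z) * c" for h
      by (simp add: k_def flip: mult.assoc)
    with tendsto_mult_right[OF ind[OF base(1), unfolded Q_def], of c] show ?case
      by (simp add: Q_def)
  next
    case (add f g)
    have "(LINT z|?N. k h (\<lambda>z. f z + g z) z) = (LINT z|?N. k h f z) + (LINT z|?N. k h g z)"
      if h: "h \<in> borel_measurable M" "\<And>x. \<bar>h x\<bar> \<le> b" for h
      unfolding Bochner_Integration.integral_add[OF k_int[OF add(1) h] k_int[OF add(2) h], symmetric]
      by (simp add: k_def distrib_left)
    from this[OF \<eta>(1) bounds(1)] this[OF \<eta>(2) bounds(2)] show ?case
      using add unfolding Q_def by (simp add: tendsto_add)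
  next
    case (lim f s)
    show ?case
      by (rule closed[where s = s and g = "\<lambda>z. 2 * \<bar>f z\<bar>"]) (use lim in auto)
  qed
  then show ?thesis by (simp add: Q_def k_def)
qed

section \<open>Lebesgue measure on a product\<close>

lemma nn_integral_lborel_shift:
  fixes f :: "'a::euclidean_space \<Rightarrow> ennreal"
  assumes [measurable]: "f \<in> borel_measurable borel"
  shows "(\<integral>\<^sup>+x. f (x + c) \<partial>lborel) = (\<integral>\<^sup>+x. f x \<partial>lborel)"
proof -
  have "(\<integral>\<^sup>+x. f x \<partial>lborel) = (\<integral>\<^sup>+x. f x \<partial>distr lborel borel ((+) c))"
    by (simp add: lborel_distr_plus)
  also have "\<dots> = (\<integral>\<^sup>+x. f (c + x) \<partial>lborel)"
    by (subst nn_integral_distr) auto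
  finally show ?thesis by (simp add: add.commute)
qed

lemma nn_integral_lborel_fst:
  fixes f :: "'a::euclidean_space \<times> 'b::euclidean_space \<Rightarrow> ennreal"
  assumes "f \<in> borel_measurable borel"
  shows "(\<integral>\<^sup>+x. \<integral>\<^sup>+y. f (x, y) \<partial>lborel \<partial>lborel) = (\<integral>\<^sup>+z. f z \<partial>lborel)"
  using lborel.nn_integral_fst[of f lborel] assms by (simp add: lborel_prod)

lemma nn_integral_lborel_snd:
  fixes f :: "'a::euclidean_space \<times> 'b::euclidean_space \<Rightarrow> ennreal"
  assumes "f \<in> borel_measurable borel"
  shows "(\<integral>\<^sup>+y. \<integral>\<^sup>+x. f (x, y) \<partial>lborel \<partial>lborel) = (\<integral>\<^sup>+z. f z \<partial>lborel)"
  using lborel_pair.nn_integral_snd[of f] assms by (simp add: lborel_prod)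

text \<open>
  A Borel map pulls Lebesgue measurable functions back to Lebesgue measurable functions, and statements
  that hold almost everywhere to such statements, once the preimages of null sets are null. The maps in
  question are the projections of a product and the difference of its coordinates.
\<close>

definition nonsingular_map :: "('a::euclidean_space \<Rightarrow> 'b::euclidean_space) \<Rightarrow> bool" where
  "nonsingular_map T \<longleftrightarrow> T \<in> borel_measurable borel \<and> (\<forall>N\<in>null_sets lborel. T -` N \<in> null_sets lborel)"

lemma nonsingular_map_fst: "nonsingular_map (fst :: 'a::euclidean_space \<times> 'b::euclidean_space \<Rightarrow> 'a)"
  unfolding nonsingular_map_def
proof safe
  fix N :: "'a set" assume N: "N \<in> null_sets lborel"
  then have [measurable]: "N \<in> sets borel" by auto
  have "emeasure lborel (N \<times> (UNIV :: 'b set)) = emeasure lborel N * emeasure lborel (UNIV :: 'b set)"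
    using lborel.emeasure_pair_measure_Times[of N lborel "UNIV :: 'b set"] by (simp add: lborel_prod)
  also have "\<dots> = 0" using N by (simp add: null_sets_def)
  moreover have "fst -` N = N \<times> (UNIV :: 'b set)" by auto
  ultimately show "fst -` N \<in> null_sets (lborel :: ('a \<times> 'b) measure)"
    by (intro null_setsI) (auto simp: borel_Times)
qed (intro borel_measurable_continuous_onI continuous_intros)

lemma nonsingular_map_snd: "nonsingular_map (snd :: 'a::euclidean_space \<times> 'b::euclidean_space \<Rightarrow> 'b)"
  unfolding nonsingular_map_def
proof safe
  fix N :: "'b set" assume N: "N \<in> null_sets lborel"
  then have [measurable]: "N \<in> sets borel" by auto
  have "emeasure lborel ((UNIV :: 'a set) \<times> N) = emeasure lborel (UNIV :: 'a set) * emeasure lborel N"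
    using lborel.emeasure_pair_measure_Times[of "UNIV :: 'a set" lborel N] by (simp add: lborel_prod)
  also have "\<dots> = 0" using N by (simp add: null_sets_def)
  moreover have "snd -` N = (UNIV :: 'a set) \<times> N" by auto
  ultimately show "snd -` N \<in> null_sets (lborel :: ('a \<times> 'b) measure)"
    by (intro null_setsI) (auto simp: borel_Times)
qed (intro borel_measurable_continuous_onI continuous_intros)

text \<open>
  For each fixed \<open>y\<close> the section of the preimage is a translate of the null set, so Fubini applies.
\<close>

lemma nonsingular_map_diff:
  "nonsingular_map (\<lambda>z :: 'a::euclidean_space \<times> 'a. fst z - snd z)"
  unfolding nonsingular_map_def
proof safe
  show meas [measurable]: "(\<lambda>z :: 'a \<times> 'a. fst z - snd z) \<in> borel_measurable borel"
    by (intro borel_measurable_continuous_onI continuous_intros)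
  fix N :: "'a set" assume N: "N \<in> null_sets lborel"
  then have Nm [measurable]: "N \<in> sets borel" by auto
  have pre: "(\<lambda>z :: 'a \<times> 'a. fst z - snd z) -` N \<in> sets borel"
    using measurable_sets[OF meas Nm] by simp
  then have ind [measurable]: "(\<lambda>z :: 'a \<times> 'a. indicator N (fst z - snd z) :: ennreal) \<in> borel_measurable borel"
    by measurable
  have "emeasure lborel ((\<lambda>z :: 'a \<times> 'a. fst z - snd z) -` N)
      = (\<integral>\<^sup>+z. indicator ((\<lambda>z :: 'a \<times> 'a. fst z - snd z) -` N) z \<partial>lborel)"
    using pre by simp
  also have "\<dots> = (\<integral>\<^sup>+z. indicator N (fst z - snd z :: 'a) \<partial>lborel)"
    by (intro nn_integral_cong) (auto simp: indicator_def)
  also have "\<dots> = (\<integral>\<^sup>+y. \<integral>\<^sup>+x. indicator N (x - y :: 'a) \<partial>lborel \<partial>lborel)"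
    using nn_integral_lborel_snd[OF ind] by simp
  also have "\<dots> = (\<integral>\<^sup>+y. \<integral>\<^sup>+x. indicator N x \<partial>(lborel :: 'a measure) \<partial>(lborel :: 'a measure))"
    using nn_integral_lborel_shift[of "indicator N :: 'a \<Rightarrow> ennreal" "- _"] by simp
  also have "\<dots> = 0" using N by (simp add: null_sets_def)
  finally show "(\<lambda>z :: 'a \<times> 'a. fst z - snd z) -` N \<in> null_sets lborel"
    using pre by (intro null_setsI) auto
qed

lemma nonsingular_map_measurable:
  assumes "nonsingular_map T"
  shows "T \<in> lebesgue \<rightarrow>\<^sub>M lebesgue"
proof (rule completion.measurable_completion2)
  have T: "T \<in> lborel \<rightarrow>\<^sub>M lborel" using assms by (simp add: nonsingular_map_def)
  then show "T \<in> lebesgue \<rightarrow>\<^sub>M lborel" by (rule measurable_completion)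
  show "null_sets lborel \<subseteq> null_sets (distr lebesgue lborel T)"
    unfolding distr_completion[OF T]
    using assms by (auto simp: null_sets_distr_iff[OF T] nonsingular_map_def) (metis null_setsD2 sets_lborel)
qed

lemma nonsingular_map_AE:
  assumes "nonsingular_map T" "AE x in lborel. P x"
  shows "AE z in lborel. P (T z)"
proof -
  obtain N where "N \<in> null_sets lborel" "{x. \<not> P x} \<subseteq> N"
    using assms(2) by (auto elim!: AE_E simp: null_sets_def)
  then show ?thesis
    using assms(1) by (intro AE_I'[of "T -` N"]) (auto simp: nonsingular_map_def)
qed

lemma nonsingular_map_measurable_on:
  assumes T: "nonsingular_map T" "T \<in> A \<rightarrow> B" and u: "u \<in> borel_measurable (lebesgue_on B)"
  shows "(\<lambda>z. u (T z)) \<in> borel_measurable (lebesgue_on A)"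
  using measurable_restrict_space3[OF nonsingular_map_measurable[OF T(1)] T(2)] u
  by (rule measurable_compose)

lemma nonsingular_map_AE_on:
  assumes T: "nonsingular_map T" "T \<in> A \<rightarrow> B" and "A \<in> sets lebesgue" "B \<in> sets lebesgue"
    and P: "AE x in lebesgue_on B. P x"
  shows "AE z in lebesgue_on A. P (T z)"
proof -
  have "AE x in lborel. x \<in> B \<longrightarrow> P x"
    using P assms(4) by (simp add: AE_restrict_space_iff AE_completion_iff)
  from nonsingular_map_AE[OF T(1) this]
  have "AE z in lborel. z \<in> A \<longrightarrow> P (T z)"
    by eventually_elim (use T(2) in auto)
  then show ?thesis
    using assms(3) by (simp add: AE_restrict_space_iff AE_completion_iff)
qed
lemma L2_on_eq: "L2_on S = square_integrable (lebesgue_on S)"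
  by (simp add: L2_on_def square_integrable_def)

lemma square_integrable_subset:
  assumes "u \<in> square_integrable (lebesgue_on T)" "S \<subseteq> T" "S \<in> sets lebesgue" "T \<in> sets lebesgue"
  shows "u \<in> square_integrable (lebesgue_on S)"
    and "(LINT x|lebesgue_on S. (u x)\<^sup>2) \<le> (LINT x|lebesgue_on T. (u x)\<^sup>2)"
proof -
  have i: "integrable (lebesgue_on T) (\<lambda>x. (u x)\<^sup>2)" and m: "u \<in> borel_measurable (lebesgue_on T)"
    using assms(1) by (auto simp: square_integrable_def)
  have iS: "integrable (lebesgue_on S) (\<lambda>x. (u x)\<^sup>2)"
  proof -
    have "integrable lebesgue (\<lambda>x. indicator S x *\<^sub>R (indicator T x *\<^sub>R (u x)\<^sup>2))"
      using i assms by (intro integrable_mult_indicator[OF assms(3)]) (simp add: integrable_restrict_space)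
    moreover have "(\<lambda>x. indicator S x *\<^sub>R (indicator T x *\<^sub>R (u x)\<^sup>2)) = (\<lambda>x. indicator S x *\<^sub>R (u x)\<^sup>2)"
      using assms(2) by (auto simp: indicator_def fun_eq_iff)
    ultimately have "integrable lebesgue (\<lambda>x. indicator S x *\<^sub>R (u x)\<^sup>2)" by simp
    then show ?thesis using assms by (subst integrable_restrict_space) auto
  qed
  then show "u \<in> square_integrable (lebesgue_on S)"
    using measurable_restrict_mono[OF m assms(2)] by (simp add: square_integrable_def)
  have "(LINT x|lebesgue. indicator S x *\<^sub>R (u x)\<^sup>2) \<le> (LINT x|lebesgue. indicator T x *\<^sub>R (u x)\<^sup>2)"
    using i iS assms
    by (intro integral_mono) (auto simp: integrable_restrict_space indicator_def)
  then show "(LINT x|lebesgue_on S. (u x)\<^sup>2) \<le> (LINT x|lebesgue_on T. (u x)\<^sup>2)"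
    using assms by (simp add: integral_restrict_space)
qed
text \<open>
  The completed Lebesgue measure on a product is not the product of the completed measures. Integrals are
  moved to Borel versions of the functions, for which Fubini and the product measure are at hand.
\<close>

lemma borel_version:
  fixes h :: "'a::euclidean_space \<Rightarrow> real"
  assumes h: "h \<in> borel_measurable (lebesgue_on S)" and S: "S \<in> sets lebesgue"
  obtains g where "g \<in> borel_measurable borel" "AE x in lebesgue_on S. h x = g x"
proof -
  have "(\<lambda>x. indicator S x *\<^sub>R h x) \<in> borel_measurable lebesgue"
    using h S by (subst (asm) borel_measurable_restrict_space_iff) auto
  then obtain g where g: "g \<in> borel_measurable lborel" "AE x in lborel. indicator S x *\<^sub>R h x = g x"
    using completion_ex_borel_measurable_real by blast
  have "AE x in lborel. x \<in> S \<longrightarrow> h x = g x"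
    using g(2) by eventually_elim auto
  then show ?thesis
    using that[of g] g(1) S by (simp add: AE_restrict_space_iff AE_completion_iff)
qed

lemma clamped_borel_version:
  fixes h :: "'a::euclidean_space \<Rightarrow> real"
  assumes h: "h \<in> borel_measurable (lebesgue_on S)" and S: "S \<in> sets lebesgue"
    and AE: "AE x in lebesgue_on S. a \<le> h x \<and> h x \<le> b" and ab: "a \<le> b"
  obtains g where "g \<in> borel_measurable borel" "AE x in lebesgue_on S. h x = g x"
    and "\<And>x. a \<le> g x" "\<And>x. g x \<le> b"
proof -
  obtain g where g: "g \<in> borel_measurable borel" "AE x in lebesgue_on S. h x = g x"
    by (rule borel_version[OF h S])
  show ?thesis
  proof (rule that[of "\<lambda>x. max a (min b (g x))"])
    show "(\<lambda>x. max a (min b (g x))) \<in> borel_measurable borel" using g(1) by measurable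
    show "AE x in lebesgue_on S. h x = max a (min b (g x))"
      using g(2) AE by eventually_elim auto
  qed (use ab in auto)
qed

text \<open>
  The measure \<open>density lborel (indicator S)\<close> is the restriction of the uncompleted measure to \<open>S\<close> with
  the whole space kept as carrier, a form in which its square is computed at once.
\<close>

lemma lebesgue_on_density:
  fixes g :: "'a::euclidean_space \<Rightarrow> real"
  assumes S: "S \<in> sets borel" and g: "g \<in> borel_measurable borel"
  shows "(LINT x|density lborel (indicator S). g x) = (LINT x|lebesgue_on S. g x)"
    and "integrable (density lborel (indicator S)) g \<longleftrightarrow> integrable (lebesgue_on S) g"
proof -
  have SL: "S \<in> sets lebesgue" using S by auto
  have m: "(\<lambda>x. indicator S x *\<^sub>R g x) \<in> borel_measurable lborel" using S g by simp
  have e: "density lborel (indicator S) = density lborel (\<lambda>x. ennreal (indicator S x))"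
    by (simp add: ennreal_indicator)
  have "(LINT x|density lborel (indicator S). g x) = (LINT x|lborel. indicator S x *\<^sub>R g x)"
    unfolding e using S g by (intro integral_density) auto
  also have "\<dots> = (LINT x|lebesgue. indicator S x *\<^sub>R g x)"
    by (rule integral_completion[OF m, symmetric])
  also have "\<dots> = (LINT x|lebesgue_on S. g x)"
    using SL by (subst integral_restrict_space) auto
  finally show "(LINT x|density lborel (indicator S). g x) = (LINT x|lebesgue_on S. g x)" .
  have "integrable (density lborel (indicator S)) g \<longleftrightarrow> integrable lborel (\<lambda>x. indicator S x *\<^sub>R g x)"
    unfolding e using S g by (intro integrable_density) auto
  also have "\<dots> \<longleftrightarrow> integrable lebesgue (\<lambda>x. indicator S x *\<^sub>R g x)"
    by (rule integrable_completion[OF m, symmetric])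
  also have "\<dots> \<longleftrightarrow> integrable (lebesgue_on S) g"
    using SL by (subst integrable_restrict_space) auto
  finally show "integrable (density lborel (indicator S)) g \<longleftrightarrow> integrable (lebesgue_on S) g" .
qed

lemma density_indicator_Times:
  fixes S :: "'a::euclidean_space set"
  assumes S: "S \<in> sets borel" and fin: "finite_measure (density lborel (indicator S))"
  shows "density lborel (indicator S) \<Otimes>\<^sub>M density lborel (indicator S) = density lborel (indicator (S \<times> S))"
proof -
  interpret finite_measure "density lborel (indicator S)" by fact
  have "density lborel (indicator S) \<Otimes>\<^sub>M density lborel (indicator S)
      = density (lborel \<Otimes>\<^sub>M lborel) (\<lambda>(x, y). indicator S x * indicator S y)"
    using S by (intro pair_measure_density) (auto intro: sigma_finite_measure_axioms sigma_finite_lborel)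
  also have "(\<lambda>(x, y). indicator S x * indicator S y) = (indicator (S \<times> S) :: _ \<Rightarrow> ennreal)"
    by (auto simp: indicator_def fun_eq_iff)
  finally show ?thesis by (simp add: lborel_prod)
qed

section \<open>Test functions\<close>

lemma Ck_comb:
  assumes "Ck k \<phi>" "Ck k \<psi>"
  shows "Ck k (\<lambda>x. \<phi> x + c * \<psi> x)"
  using assms
proof (induction k arbitrary: \<phi> \<psi>)
  case 0
  then show ?case by (auto intro!: continuous_intros)
next
  case (Suc k)
  then have d: "\<phi> differentiable (at x)" "\<psi> differentiable (at x)" for x by auto
  have der: "((\<lambda>x. \<phi> x + c * \<psi> x) has_derivative
      (\<lambda>h. frechet_derivative \<phi> (at x) h + c * frechet_derivative \<psi> (at x) h)) (at x)" for x
    using d[of x, unfolded frechet_derivative_works]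
    by (intro has_derivative_add has_derivative_mult_right) auto
  then have "frechet_derivative (\<lambda>x. \<phi> x + c * \<psi> x) (at x) =
      (\<lambda>h. frechet_derivative \<phi> (at x) h + c * frechet_derivative \<psi> (at x) h)" for x
    using frechet_derivative_at[OF der] by simp
  moreover have "(\<lambda>x. \<phi> x + c * \<psi> x) differentiable (at x)" for x
    using der unfolding differentiable_def by blast
  ultimately show ?case
    using Suc by simp
qed

lemma Cc_inf_comb:
  assumes "\<phi> \<in> Cc_inf \<Omega>" "\<psi> \<in> Cc_inf \<Omega>"
  shows "(\<lambda>x. \<phi> x + c * \<psi> x) \<in> Cc_inf \<Omega>"
proof -
  have "supp (\<lambda>x. \<phi> x + c * \<psi> x) \<subseteq> closure ({x. \<phi> x \<noteq> 0} \<union> {x. \<psi> x \<noteq> 0})"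
    unfolding supp_def by (intro closure_mono) auto
  also have "\<dots> = supp \<phi> \<union> supp \<psi>" by (simp add: supp_def)
  finally have sub: "supp (\<lambda>x. \<phi> x + c * \<psi> x) \<subseteq> supp \<phi> \<union> supp \<psi>" .
  have "compact (supp \<phi> \<union> supp \<psi>)"
    using assms by (auto simp: Cc_inf_def)
  then have "compact (supp (\<lambda>x. \<phi> x + c * \<psi> x))"
    using compact_Int_closed[of "supp \<phi> \<union> supp \<psi>" "supp (\<lambda>x. \<phi> x + c * \<psi> x)"] sub
    by (simp add: supp_def Int_absorb1)
  then show ?thesis
    using assms sub by (auto simp: Cc_inf_def Ck_comb)
qed

lemma zero_in_Cc_inf:
  fixes \<Omega> :: "(real ^ 'n) set"
  shows "(\<lambda>_. 0) \<in> Cc_inf \<Omega>"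
proof -
  have "Ck k (\<lambda>_ :: real ^ 'n. 0)" for k
  proof (induction k)
    case (Suc k)
    have "frechet_derivative (\<lambda>_ :: real ^ 'n. 0 :: real) (at x) = (\<lambda>_. 0)" for x
      by (rule frechet_derivative_at[symmetric]) simp
    with Suc show ?case by simp
  qed simp
  moreover have "supp (\<lambda>_ :: real ^ 'n. 0 :: real) = {}" by (simp add: supp_def)
  ultimately show ?thesis by (simp add: Cc_inf_def)
qed

lemma Cc_inf_continuous: "\<phi> \<in> Cc_inf \<Omega> \<Longrightarrow> continuous_on UNIV \<phi>"
  using Ck.simps(1) by (auto simp: Cc_inf_def simp del: Ck.simps)

lemma Cc_inf_vanishes: "\<phi> \<in> Cc_inf \<Omega> \<Longrightarrow> x \<notin> \<Omega> \<Longrightarrow> \<phi> x = 0"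
  using closure_subset[of "{x. \<phi> x \<noteq> 0}"] by (auto simp: Cc_inf_def supp_def)

text \<open>
  The mean value inequality on a ball that contains the set: there the partial derivatives are bounded by
  compactness.
\<close>

lemma C1_Lipschitz_on_bounded:
  fixes \<phi> :: "real ^ 'n \<Rightarrow> real"
  assumes "Ck 1 \<phi>" "bounded S"
  obtains L where "\<And>x y. x \<in> S \<Longrightarrow> y \<in> S \<Longrightarrow> \<bar>\<phi> x - \<phi> y\<bar> \<le> L * norm (x - y)"
proof -
  obtain R where R: "S \<subseteq> cball 0 R"
    using assms(2) unfolding bounded_iff by (metis mem_cball_0 subsetI)
  let ?f = "\<lambda>x. frechet_derivative \<phi> (at x)"
  have d: "(\<phi> has_derivative ?f x) (at x)" for x
    using assms(1) by (simp add: frechet_derivative_works)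
  have "\<exists>B. \<forall>x\<in>cball 0 R. \<bar>?f x (axis i 1)\<bar> \<le> B" for i
  proof -
    have "continuous_on (cball 0 R) (\<lambda>x. ?f x (axis i 1))"
      using assms(1) by (auto intro: continuous_on_subset)
    then have "bounded ((\<lambda>x. ?f x (axis i 1)) ` cball 0 R)"
      by (intro compact_imp_bounded compact_continuous_image compact_cball)
    then show ?thesis by (auto simp: bounded_iff)
  qed
  then obtain B where B: "\<And>i x. x \<in> cball 0 R \<Longrightarrow> \<bar>?f x (axis i 1)\<bar> \<le> B i" by metis
  have on: "onorm (?f x) \<le> (\<Sum>i\<in>UNIV. B i)" if x: "x \<in> cball 0 R" for x
  proof (rule onorm_le)
    fix h :: "real ^ 'n"
    interpret bounded_linear "?f x" by (rule has_derivative_bounded_linear[OF d])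
    have "?f x h = ?f x (\<Sum>i\<in>UNIV. (h $ i) *\<^sub>R axis i 1)"
      using basis_expansion[of h] by (simp add: scalar_mult_eq_scaleR)
    also have "\<dots> = (\<Sum>i\<in>UNIV. (h $ i) * ?f x (axis i 1))"
      by (simp add: sum scaleR)
    also have "\<bar>\<dots>\<bar> \<le> (\<Sum>i\<in>UNIV. \<bar>(h $ i) * ?f x (axis i 1)\<bar>)" by (rule sum_abs)
    also have "\<dots> \<le> (\<Sum>i\<in>UNIV. norm h * B i)"
      unfolding abs_mult using B[OF x] component_le_norm_cart[of h]
      by (intro sum_mono mult_mono) auto
    finally show "norm (?f x h) \<le> (\<Sum>i\<in>UNIV. B i) * norm h"
      by (simp add: sum_distrib_left mult.commute)
  qed
  show ?thesis
  proof (rule that)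
    fix x y assume "x \<in> S" "y \<in> S"
    then have "x \<in> cball 0 R" "y \<in> cball 0 R" using R by auto
    then show "\<bar>\<phi> x - \<phi> y\<bar> \<le> (\<Sum>i\<in>UNIV. B i) * norm (x - y)"
      using differentiable_bound[OF convex_cball has_derivative_at_withinI[OF d] on, of 0 R x y]
      by auto
  qed
qed
text \<open>
  If \<open>norm x < R\<close> then \<open>x + m h\<close> is outside the ball of radius \<open>R\<close>, so \<open>\<phi> x\<close> telescopes into the \<open>m\<close>
  increments of \<open>\<phi>\<close> between \<open>x\<close> and \<open>x + m h\<close>. Each of them has, by translation invariance, the same
  \<open>L\<^sup>2\<close> norm as the first.
\<close>

lemma translation_Poincare:
  fixes \<phi> :: "'a::euclidean_space \<Rightarrow> real"
  assumes \<phi>: "\<phi> \<in> borel_measurable borel" "\<And>x. R \<le> norm x \<Longrightarrow> \<phi> x = 0"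
    and h: "2 * R \<le> real m * norm h"
  shows "(\<integral>\<^sup>+x. ennreal ((\<phi> x)\<^sup>2) \<partial>lborel)
     \<le> ennreal ((real m)\<^sup>2) * (\<integral>\<^sup>+x. ennreal ((\<phi> (x + h) - \<phi> x)\<^sup>2) \<partial>lborel)"
proof -
  note [measurable] = \<phi>(1)
  define d where "d k x = (\<phi> (x + real (Suc k) *\<^sub>R h) - \<phi> (x + real k *\<^sub>R h))\<^sup>2" for k x
  have "(\<phi> x)\<^sup>2 \<le> real m * (\<Sum>k<m. d k x)" for x
  proof (cases "norm x < R")
    case True
    have "real m * norm h \<le> norm (x + real m *\<^sub>R h) + norm x"
      using norm_triangle_ineq4[of "x + real m *\<^sub>R h" x] by simp
    then have "\<phi> (x + real m *\<^sub>R h) = 0"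
      using h True by (intro \<phi>(2)) linarith
    then have "\<phi> x = - (\<Sum>k<m. \<phi> (x + real (Suc k) *\<^sub>R h) - \<phi> (x + real k *\<^sub>R h))"
      unfolding sum_lessThan_telescope[of "\<lambda>k. \<phi> (x + real k *\<^sub>R h)"] by simp
    then have "(\<phi> x)\<^sup>2 = (\<Sum>k<m. \<phi> (x + real (Suc k) *\<^sub>R h) - \<phi> (x + real k *\<^sub>R h))\<^sup>2"
      by simp
    also have "\<dots> \<le> (\<Sum>k<m. d k x) * real (card {..<m})"
      unfolding d_def by (rule sum_squared_le_sum_of_squares)
    finally show ?thesis by (simp add: mult.commute)
  next
    case False
    then have "(\<phi> x)\<^sup>2 = 0" using \<phi>(2)[of x] by simp
    then show ?thesis by (simp add: d_def sum_nonneg)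
  qed
  then have "(\<integral>\<^sup>+x. ennreal ((\<phi> x)\<^sup>2) \<partial>lborel) \<le> (\<integral>\<^sup>+x. ennreal (real m) * (\<Sum>k<m. ennreal (d k x)) \<partial>lborel)"
    by (intro nn_integral_mono)
       (simp add: d_def[abs_def] sum_nonneg ennreal_leI flip: ennreal_mult')
  also have "\<dots> = ennreal (real m) * (\<Sum>k<m. \<integral>\<^sup>+x. ennreal (d k x) \<partial>lborel)"
    unfolding d_def by (subst nn_integral_cmult) (simp_all add: nn_integral_sum del: sum_ennreal)
  also have "(\<lambda>k. \<integral>\<^sup>+x. ennreal (d k x) \<partial>lborel) = (\<lambda>k. \<integral>\<^sup>+x. ennreal ((\<phi> (x + h) - \<phi> x)\<^sup>2) \<partial>lborel)"
  proof
    fix k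
    have "d k x = (\<phi> ((x + real k *\<^sub>R h) + h) - \<phi> (x + real k *\<^sub>R h))\<^sup>2" for x
      by (simp add: d_def algebra_simps)
    then show "(\<integral>\<^sup>+x. ennreal (d k x) \<partial>lborel) = (\<integral>\<^sup>+x. ennreal ((\<phi> (x + h) - \<phi> x)\<^sup>2) \<partial>lborel)"
      using nn_integral_lborel_shift[of "\<lambda>x. ennreal ((\<phi> (x + h) - \<phi> x)\<^sup>2)" "real k *\<^sub>R h"] by simp
  qed
  also have "ennreal (real m) * (\<Sum>k<m. \<integral>\<^sup>+x. ennreal ((\<phi> (x + h) - \<phi> x)\<^sup>2) \<partial>lborel)
     = ennreal ((real m)\<^sup>2) * (\<integral>\<^sup>+x. ennreal ((\<phi> (x + h) - \<phi> x)\<^sup>2) \<partial>lborel)"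
    by (simp add: power2_eq_square ennreal_mult mult.assoc ennreal_of_nat_eq_real_of_nat)
  finally show ?thesis .
qed

section \<open>The nonlocal energy\<close>

text \<open>
  The singular lower bound on the kernel enters as a positive lower bound near the origin; normalisation
  of the kernel enters as integrability, which puts test functions into the energy space.
\<close>

locale nonlocal_kernel =
  fixes \<Omega> :: "(real ^ 'n) set" and A :: "real \<Rightarrow> real \<Rightarrow> real" and \<delta> :: real
  assumes open_domain: "open \<Omega>" and bounded_domain: "bounded \<Omega>" and horizon_pos: "0 < \<delta>"
    and kernel_nonneg: "\<And>r. 0 \<le> r \<Longrightarrow> 0 \<le> A \<delta> r"
    and kernel_integrable: "integrable lebesgue (\<lambda>x :: real ^ 'n. A \<delta> (norm x))"
    and kernel_pos: "\<exists>c>0. \<forall>x :: real ^ 'n. x \<noteq> 0 \<longrightarrow> norm x < \<delta> / 2 \<longrightarrow> c \<le> A \<delta> (norm x)"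
begin

abbreviation D where "D \<equiv> fattening \<Omega> \<delta>"
abbreviation M where "M \<equiv> lebesgue_on D"
abbreviation M2 where "M2 \<equiv> lebesgue_on (D \<times> D)"
abbreviation form where "form \<equiv> nonlocal_form \<Omega> A \<delta>"
abbreviation energy where "energy u \<equiv> form (\<lambda>_ _. 1) u u"

text \<open>
  The difference quotient weighted by the square root of the kernel, which makes the form an \<open>L\<^sup>2\<close> inner
  product of \<open>dq u\<close> and \<open>dq v\<close> with weight \<open>\<kappa>\<close>. On the diagonal it is \<open>0\<close>, as in the form itself.
\<close>

definition dq :: "(real ^ 'n \<Rightarrow> real) \<Rightarrow> (real ^ 'n) \<times> (real ^ 'n) \<Rightarrow> real" where
  "dq u z = sqrt (A \<delta> (norm (fst z - snd z))) * (u (fst z) - u (snd z)) / norm (fst z - snd z)"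

definition elliptic :: "(real ^ 'n \<Rightarrow> real ^ 'n \<Rightarrow> real) \<Rightarrow> real \<Rightarrow> real \<Rightarrow> bool" where
  "elliptic \<kappa> a b \<longleftrightarrow> 0 < a \<and> (\<lambda>z. \<kappa> (fst z) (snd z)) \<in> borel_measurable M2 \<and>
     (AE z in M2. a \<le> \<kappa> (fst z) (snd z) \<and> \<kappa> (fst z) (snd z) \<le> b)"

lemma domain_subset: "\<Omega> \<subseteq> D"
  using horizon_pos by (auto simp: fattening_def intro!: bexI)

lemma fattening_memI: "x \<in> \<Omega> \<Longrightarrow> norm (x - y) < \<delta> \<Longrightarrow> y \<in> D"
  by (auto simp: fattening_def dist_norm)

lemma open_fattening: "open D"
  unfolding fattening_def by auto

lemma bounded_fattening: "bounded D"
proof -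
  obtain R where R: "\<And>x. x \<in> \<Omega> \<Longrightarrow> norm x \<le> R"
    using bounded_domain by (auto simp: bounded_iff)
  have "norm y \<le> R + \<delta>" if "y \<in> D" for y
  proof -
    obtain x where "x \<in> \<Omega>" "norm (y - x) < \<delta>"
      using \<open>y \<in> D\<close> by (auto simp: fattening_def dist_norm norm_minus_commute)
    then show ?thesis using R[of x] norm_triangle_sub[of y x] by simp
  qed
  then show ?thesis by (auto simp: bounded_iff)
qed

lemma domain_sets [simp]: "\<Omega> \<in> sets borel" "\<Omega> \<in> sets lebesgue"
  using open_domain by auto

lemma fattening_sets [simp]: "D \<in> sets borel" "D \<in> sets lebesgue"
  using open_fattening by auto

lemma fattening_sets2 [simp]: "D \<times> D \<in> sets borel" "D \<times> D \<in> sets lebesgue"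
proof -
  show "D \<times> D \<in> sets borel" using open_fattening by (intro borel_open open_Times)
  then show "D \<times> D \<in> sets lebesgue" by auto
qed

lemma finite_emeasure_fattening: "emeasure lborel D < \<infinity>"
  using bounded_fattening by (rule emeasure_bounded_finite)

lemma finite_measure_fattening: "finite_measure M"
  by (rule finite_measureI) (use finite_emeasure_fattening in \<open>simp add: emeasure_restrict_space\<close>)

lemma kernel_measurable2: "(\<lambda>z. A \<delta> (norm (fst z - snd z))) \<in> borel_measurable M2"
  using measurable_compose[OF nonsingular_map_measurable[OF nonsingular_map_diff]
      borel_measurable_integrable[OF kernel_integrable]]
  by (rule measurable_restrict_space1)

lemma fst_measurable_on: "u \<in> borel_measurable M \<Longrightarrow> (\<lambda>z. u (fst z)) \<in> borel_measurable M2"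
  by (rule nonsingular_map_measurable_on[OF nonsingular_map_fst]) auto

lemma snd_measurable_on: "u \<in> borel_measurable M \<Longrightarrow> (\<lambda>z. u (snd z)) \<in> borel_measurable M2"
  by (rule nonsingular_map_measurable_on[OF nonsingular_map_snd]) auto

lemma fst_AE_on: "AE x in M. P x \<Longrightarrow> AE z in M2. P (fst z)"
  by (rule nonsingular_map_AE_on[OF nonsingular_map_fst]) auto

lemma snd_AE_on: "AE x in M. P x \<Longrightarrow> AE z in M2. P (snd z)"
  by (rule nonsingular_map_AE_on[OF nonsingular_map_snd]) auto

lemma norm_diff_measurable2: "(\<lambda>z :: (real ^ 'n) \<times> (real ^ 'n). norm (fst z - snd z)) \<in> borel_measurable M2"
proof -
  have "(\<lambda>z :: (real ^ 'n) \<times> (real ^ 'n). norm (fst z - snd z)) \<in> borel_measurable borel"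
    by (intro borel_measurable_continuous_onI continuous_intros)
  then have "(\<lambda>z :: (real ^ 'n) \<times> (real ^ 'n). norm (fst z - snd z)) \<in> borel_measurable lebesgue"
    by (simp add: measurable_completion)
  then show ?thesis by (rule measurable_restrict_space1)
qed

lemma dq_measurable: "u \<in> borel_measurable M \<Longrightarrow> dq u \<in> borel_measurable M2"
  unfolding dq_def
  by (intro borel_measurable_divide borel_measurable_times measurable_compose[OF _ borel_measurable_sqrt]
      borel_measurable_diff kernel_measurable2 fst_measurable_on snd_measurable_on norm_diff_measurable2)

lemma form_integrand_eq:
  "form_integrand A \<delta> \<kappa> u v = (\<lambda>z. \<kappa> (fst z) (snd z) * (dq u z * dq v z))"
proof
  fix z
  have "dq u z * dq v z = (sqrt (A \<delta> (norm (fst z - snd z))) * sqrt (A \<delta> (norm (fst z - snd z)))) *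
     (((u (fst z) - u (snd z)) / norm (fst z - snd z)) * ((v (fst z) - v (snd z)) / norm (fst z - snd z)))"
    by (simp add: dq_def)
  also have "sqrt (A \<delta> (norm (fst z - snd z))) * sqrt (A \<delta> (norm (fst z - snd z))) = A \<delta> (norm (fst z - snd z))"
    using kernel_nonneg[of "norm (fst z - snd z)"] by simp
  finally show "form_integrand A \<delta> \<kappa> u v z = \<kappa> (fst z) (snd z) * (dq u z * dq v z)"
    by (simp add: form_integrand_def split_beta)
qed

lemma form_eq: "form \<kappa> u v = (LINT z|M2. \<kappa> (fst z) (snd z) * (dq u z * dq v z))"
  by (simp add: nonlocal_form_def form_integrand_eq)

lemma energy_eq: "energy u = (LINT z|M2. (dq u z)\<^sup>2)"
  by (simp add: form_eq power2_eq_square)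

lemma energy_nonneg: "0 \<le> energy u"
  by (simp add: energy_eq)

lemma U_space_iff:
  "u \<in> U_space \<Omega> A \<delta> \<longleftrightarrow> u \<in> square_integrable M \<and> dq u \<in> square_integrable M2"
  using dq_measurable[of u]
  by (auto simp: U_space_def L2_on_eq form_integrand_eq square_integrable_def power2_eq_square)

lemma dq_comb: "dq (\<lambda>x. u x + c * v x) = (\<lambda>z. dq u z + c * dq v z)"
  by (rule ext) (simp add: dq_def algebra_simps add_divide_distrib diff_divide_distrib)

lemma dq_diff: "dq (\<lambda>x. u x - v x) = (\<lambda>z. dq u z - dq v z)"
  using dq_comb[of u "-1" v] by simp

lemma U_space_comb:
  "u \<in> U_space \<Omega> A \<delta> \<Longrightarrow> v \<in> U_space \<Omega> A \<delta> \<Longrightarrow> (\<lambda>x. u x + c * v x) \<in> U_space \<Omega> A \<delta>"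
  by (simp add: U_space_iff dq_comb square_integrable_comb)

lemma form_integrable:
  assumes "elliptic \<kappa> a b" "u \<in> U_space \<Omega> A \<delta>" "v \<in> U_space \<Omega> A \<delta>"
  shows "integrable M2 (\<lambda>z. \<kappa> (fst z) (snd z) * (dq u z * dq v z))"
proof (rule Bochner_Integration.integrable_bound)
  show "integrable M2 (\<lambda>z. b * (dq u z * dq v z))"
    using assms by (intro integrable_mult_right square_integrable_mult) (auto simp: U_space_iff)
  show "(\<lambda>z. \<kappa> (fst z) (snd z) * (dq u z * dq v z)) \<in> borel_measurable M2"
    using assms by (auto simp: U_space_iff elliptic_def square_integrable_def)
  have "0 < a" using assms by (simp add: elliptic_def)
  have "AE z in M2. a \<le> \<kappa> (fst z) (snd z) \<and> \<kappa> (fst z) (snd z) \<le> b"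
    using assms by (simp add: elliptic_def)
  then show "AE z in M2. norm (\<kappa> (fst z) (snd z) * (dq u z * dq v z)) \<le> norm (b * (dq u z * dq v z))"
    by eventually_elim (use \<open>0 < a\<close> in \<open>auto simp: abs_mult intro!: mult_right_mono\<close>)
qed

lemma form_nonneg_form:
  assumes \<kappa>: "elliptic \<kappa> a b"
  shows "nonneg_form (U_space \<Omega> A \<delta>) (form \<kappa>)"
proof
  have "(\<lambda>_. 0) \<in> U_space \<Omega> A \<delta>"
    by (simp add: U_space_iff dq_def[abs_def] square_integrable_def)
  then show "U_space \<Omega> A \<delta> \<noteq> {}" by blast
next
  fix u v w c assume uvw: "u \<in> U_space \<Omega> A \<delta>" "v \<in> U_space \<Omega> A \<delta>" "w \<in> U_space \<Omega> A \<delta>"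
  have "form \<kappa> u w + c * form \<kappa> v w
      = (LINT z|M2. \<kappa> (fst z) (snd z) * (dq u z * dq w z) + c * (\<kappa> (fst z) (snd z) * (dq v z * dq w z)))"
    unfolding form_eq
    using form_integrable[OF \<kappa> uvw(1,3)] form_integrable[OF \<kappa> uvw(2,3)] by simp
  then show "form \<kappa> (\<lambda>x. u x + c * v x) w = form \<kappa> u w + c * form \<kappa> v w"
    by (simp add: form_eq dq_comb algebra_simps)
next
  fix u
  have "0 < a" "AE z in M2. a \<le> \<kappa> (fst z) (snd z) \<and> \<kappa> (fst z) (snd z) \<le> b"
    using \<kappa> by (auto simp: elliptic_def)
  then have "AE z in M2. 0 \<le> \<kappa> (fst z) (snd z) * (dq u z * dq u z)" by auto
  then show "0 \<le> form \<kappa> u u" unfolding form_eq by (rule integral_nonneg_AE)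
qed (auto simp: U_space_comb form_eq mult.commute)

lemma form_bounds:
  assumes \<kappa>: "elliptic \<kappa> a b" and u: "u \<in> U_space \<Omega> A \<delta>"
  shows "a * energy u \<le> form \<kappa> u u" "form \<kappa> u u \<le> b * energy u"
proof -
  have AE: "AE z in M2. a \<le> \<kappa> (fst z) (snd z) \<and> \<kappa> (fst z) (snd z) \<le> b"
    using \<kappa> by (auto simp: elliptic_def)
  have i: "integrable M2 (\<lambda>z. c * (dq u z * dq u z))" for c
    using u by (intro integrable_mult_right square_integrable_mult) (auto simp: U_space_iff)
  have "(LINT z|M2. a * (dq u z * dq u z)) \<le> form \<kappa> u u"
    unfolding form_eq using AE
    by (intro integral_mono_AE i form_integrable[OF \<kappa> u u])
       (erule eventually_mono, simp add: mult_right_mono)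
  then show "a * energy u \<le> form \<kappa> u u" by (simp add: form_eq)
  have "form \<kappa> u u \<le> (LINT z|M2. b * (dq u z * dq u z))"
    unfolding form_eq using AE
    by (intro integral_mono_AE i form_integrable[OF \<kappa> u u])
       (erule eventually_mono, simp add: mult_right_mono)
  then show "form \<kappa> u u \<le> b * energy u" by (simp add: form_eq)
qed

text \<open>
  Integrating first over \<open>x\<close> gives the integral of the kernel, for every \<open>y\<close>; the set \<open>D\<close> over which \<open>y\<close>
  ranges has finite measure.
\<close>

lemma kernel_integrable2: "integrable M2 (\<lambda>z. A \<delta> (norm (fst z - snd z)))"
proof (rule integrableI_bounded[OF kernel_measurable2])
  obtain g where g [measurable]: "g \<in> borel_measurable borel"
    and AEg: "AE x in lborel. A \<delta> (norm (x :: real ^ 'n)) = g x"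
    using completion_ex_borel_measurable_real[OF borel_measurable_integrable[OF kernel_integrable]] by auto
  have AEg2: "AE z in lborel. A \<delta> (norm (fst z - snd z :: real ^ 'n)) = g (fst z - snd z)"
    by (rule nonsingular_map_AE[OF nonsingular_map_diff AEg])
  have diff_m: "(\<lambda>z :: (real ^ 'n) \<times> (real ^ 'n). fst z - snd z) \<in> borel_measurable borel"
    by (intro borel_measurable_continuous_onI continuous_intros)
  have snd_m: "(\<lambda>z :: (real ^ 'n) \<times> (real ^ 'n). snd z) \<in> borel_measurable borel"
    by (intro borel_measurable_continuous_onI continuous_intros)
  have fin: "(\<integral>\<^sup>+x. ennreal (g x) \<partial>lborel) < \<infinity>"
  proof -
    have "(\<integral>\<^sup>+x. ennreal (g x) \<partial>lborel) = (\<integral>\<^sup>+x. ennreal (norm (A \<delta> (norm (x :: real ^ 'n)))) \<partial>lborel)"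
      using AEg by (intro nn_integral_cong_AE) (auto simp: kernel_nonneg)
    also have "\<dots> = (\<integral>\<^sup>+x. ennreal (norm (A \<delta> (norm (x :: real ^ 'n)))) \<partial>lebesgue)"
      by (simp add: nn_integral_completion)
    also have "\<dots> < \<infinity>" using kernel_integrable by (simp add: integrable_iff_bounded)
    finally show ?thesis .
  qed
  have "(\<integral>\<^sup>+z. ennreal (norm (A \<delta> (norm (fst z - snd z)))) \<partial>M2)
      = (\<integral>\<^sup>+z. ennreal (norm (A \<delta> (norm (fst z - snd z)))) * indicator (D \<times> D) z \<partial>lborel)"
    by (subst nn_integral_restrict_space) (auto simp: nn_integral_completion)
  also have "\<dots> = (\<integral>\<^sup>+z. ennreal (g (fst z - snd z)) * indicator (D \<times> D) z \<partial>lborel)"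
    using AEg2
  proof (intro nn_integral_cong_AE, eventually_elim)
    case (elim z)
    then show ?case
      using kernel_nonneg[of "norm (fst z - snd z)"] by simp
  qed
  also have "\<dots> \<le> (\<integral>\<^sup>+z. ennreal (g (fst z - snd z)) * indicator D (snd z) \<partial>lborel)"
    by (intro nn_integral_mono) (auto simp: indicator_def)
  also have "\<dots> = (\<integral>\<^sup>+y. \<integral>\<^sup>+x. ennreal (g (x - y)) * indicator D y \<partial>lborel \<partial>lborel)"
  proof -
    have "(\<lambda>z. ennreal (g (fst z - snd z)) * indicator D (snd z)) \<in> borel_measurable borel"
      by (intro borel_measurable_times_ennreal measurable_compose[OF diff_m] measurable_compose[OF snd_m]
          borel_measurable_indicator fattening_sets(1)) auto
    from nn_integral_lborel_snd[OF this] show ?thesis by simp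
  qed
  also have "\<dots> = (\<integral>\<^sup>+y. (\<integral>\<^sup>+x. ennreal (g x) \<partial>lborel) * indicator D y \<partial>lborel)"
  proof (intro nn_integral_cong)
    fix y :: "real ^ 'n"
    have "(\<integral>\<^sup>+x. ennreal (g (x - y)) * indicator D y \<partial>lborel) = (\<integral>\<^sup>+x. ennreal (g (x - y)) \<partial>lborel) * indicator D y"
      by (rule nn_integral_multc) simp
    also have "(\<integral>\<^sup>+x. ennreal (g (x - y)) \<partial>lborel) = (\<integral>\<^sup>+x. ennreal (g x) \<partial>lborel)"
      using nn_integral_lborel_shift[of "\<lambda>x. ennreal (g x)" "- y"] by simp
    finally show "(\<integral>\<^sup>+x. ennreal (g (x - y)) * indicator D y \<partial>lborel) = (\<integral>\<^sup>+x. ennreal (g x) \<partial>lborel) * indicator D y" .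
  qed
  also have "\<dots> = (\<integral>\<^sup>+x. ennreal (g x) \<partial>lborel) * emeasure lborel D"
    by (rule nn_integral_cmult_indicator) simp
  also have "\<dots> < \<infinity>"
    using fin finite_emeasure_fattening by (simp add: ennreal_mult_less_top)
  finally show "(\<integral>\<^sup>+z. ennreal (norm (A \<delta> (norm (fst z - snd z)))) \<partial>M2) < \<infinity>" .
qed

lemma Cc_inf_borel: "\<phi> \<in> Cc_inf \<Omega> \<Longrightarrow> \<phi> \<in> borel_measurable borel"
  by (intro borel_measurable_continuous_onI Cc_inf_continuous)

text \<open>
  A Lipschitz bound on \<open>\<phi>\<close> dominates \<open>(dq \<phi>)\<^sup>2\<close> by a multiple of the kernel. This also gives \<open>U0_space\<close>
  its intended meaning: the Bochner integral of a function that is not integrable is \<open>0\<close>, so \<open>U_norm\<close>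
  measures a distance only between elements of \<open>U_space\<close>.
\<close>

lemma Cc_inf_subset_U_space:
  assumes \<phi>: "\<phi> \<in> Cc_inf \<Omega>"
  shows "\<phi> \<in> U_space \<Omega> A \<delta>"
proof -
  have meas: "\<phi> \<in> borel_measurable M"
    using Cc_inf_borel[OF \<phi>] by (intro measurable_restrict_space1 measurable_completion) simp
  have "bounded (\<phi> ` closure D)"
    using bounded_fattening Cc_inf_continuous[OF \<phi>]
    by (intro compact_imp_bounded compact_continuous_image)
       (auto intro: continuous_on_subset simp: compact_closure)
  then obtain b where b: "\<And>x. x \<in> closure D \<Longrightarrow> \<bar>\<phi> x\<bar> \<le> b" by (auto simp: bounded_iff)
  have sq: "\<phi> \<in> square_integrable M"
    using b closure_subset[of D]
    by (intro square_integrable_bounded[OF finite_measure_fattening meas, of b])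
       (auto simp: space_restrict_space)
  have "Ck 1 \<phi>" using \<phi> unfolding Cc_inf_def by blast
  then obtain L where L: "\<And>x y. x \<in> D \<Longrightarrow> y \<in> D \<Longrightarrow> \<bar>\<phi> x - \<phi> y\<bar> \<le> L * norm (x - y)"
    using C1_Lipschitz_on_bounded[OF _ bounded_fattening] by metis
  have "integrable M2 (\<lambda>z. (dq \<phi> z)\<^sup>2)"
  proof (rule Bochner_Integration.integrable_bound)
    show "integrable M2 (\<lambda>z. L\<^sup>2 * A \<delta> (norm (fst z - snd z)))"
      using kernel_integrable2 by simp
    show "(\<lambda>z. (dq \<phi> z)\<^sup>2) \<in> borel_measurable M2" using dq_measurable[OF meas] by simp
    have "(dq \<phi> z)\<^sup>2 \<le> L\<^sup>2 * A \<delta> (norm (fst z - snd z))" if "z \<in> D \<times> D" for z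
    proof (cases "fst z = snd z")
      case False
      define t where "t = norm (fst z - snd z)"
      have t: "t > 0" using False by (simp add: t_def)
      have "\<bar>\<phi> (fst z) - \<phi> (snd z)\<bar> \<le> \<bar>L * t\<bar>"
        using L[of "fst z" "snd z"] that by (force simp: t_def)
      then have le: "(\<phi> (fst z) - \<phi> (snd z))\<^sup>2 \<le> (L * t)\<^sup>2"
        by (simp only: abs_le_square_iff)
      have "(dq \<phi> z)\<^sup>2 = A \<delta> t * ((\<phi> (fst z) - \<phi> (snd z))\<^sup>2 / t\<^sup>2)"
        using kernel_nonneg[of t] t by (simp add: dq_def t_def[symmetric] power_mult_distrib power_divide)
      also have "\<dots> \<le> A \<delta> t * L\<^sup>2"
        using le t kernel_nonneg[of t] by (intro mult_left_mono) (auto simp: field_simps power_mult_distrib)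
      finally show ?thesis by (simp add: t_def mult.commute)
    qed (simp add: dq_def kernel_nonneg)
    then show "AE z in M2. norm ((dq \<phi> z)\<^sup>2) \<le> norm (L\<^sup>2 * A \<delta> (norm (fst z - snd z)))"
      by (intro AE_I2) (auto simp: space_restrict_space kernel_nonneg abs_mult)
  qed
  then show ?thesis
    using sq dq_measurable[OF meas] by (simp add: U_space_iff square_integrable_def)
qed

text \<open>
  The inequality \<open>translation_Poincare\<close> is averaged over steps \<open>h\<close> in a ball that avoids the origin and on
  which the kernel is bounded below. If \<open>\<phi> (x + h) \<noteq> \<phi> x\<close>, then one of the two points lies in the domain,
  hence both lie in the fattened domain, and the double integral is bounded by the energy.
\<close>

lemma nonlocal_Poincare:
  obtains C where "0 \<le> C" "\<And>\<phi>. \<phi> \<in> Cc_inf \<Omega> \<Longrightarrow> (LINT x|M. (\<phi> x)\<^sup>2) \<le> C * energy \<phi>"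
proof -
  obtain R where R: "0 < R" "\<And>x. x \<in> \<Omega> \<Longrightarrow> norm x < R"
    using bounded_subset_ballD[OF bounded_domain, of 0] by (auto simp: subset_iff)
  obtain c where c: "0 < c" "\<And>x :: real ^ 'n. x \<noteq> 0 \<Longrightarrow> norm x < \<delta> / 2 \<Longrightarrow> c \<le> A \<delta> (norm x)"
    using kernel_pos by blast
  obtain m :: nat where m: "2 * R / (\<delta> / 4) \<le> real m" using real_arch_simple by blast
  obtain e :: "real ^ 'n" where e: "norm e = 3 * \<delta> / 8"
    using vector_choose_size[of "3 * \<delta> / 8"] horizon_pos by auto
  \<comment> \<open>all steps in \<open>S\<close> have length between \<open>\<delta> / 4\<close> and \<open>\<delta> / 2\<close>\<close>
  define S where "S = ball e (\<delta> / 8)"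
  have S: "\<delta> / 4 < norm h" "norm h < \<delta> / 2" if "h \<in> S" for h
  proof -
    have "norm (e - h) < \<delta> / 8" using that by (simp add: S_def dist_norm)
    then show "\<delta> / 4 < norm h" "norm h < \<delta> / 2"
      using e norm_triangle_ineq2[of e h] norm_triangle_ineq2[of h e] by (auto simp: norm_minus_commute)
  qed
  have S_sets [measurable]: "S \<in> sets borel" by (simp add: S_def)
  have S_fin: "emeasure lborel S < \<infinity>" unfolding S_def by (intro emeasure_bounded_finite) simp
  define \<sigma> where "\<sigma> = measure lborel S"
  have \<sigma>: "emeasure lborel S = ennreal \<sigma>"
    using S_fin by (simp add: \<sigma>_def emeasure_eq_ennreal_measure)
  have \<sigma>_pos: "0 < \<sigma>"
    unfolding \<sigma>_def S_def using horizon_pos content_ball_pos[of "\<delta> / 8" e] by simp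
  define K where "K = (real m)\<^sup>2 * ((\<delta> / 2)\<^sup>2 / c)"
  have K: "0 \<le> K" using c by (simp add: K_def)
  show ?thesis
  proof (rule that[of "K / \<sigma>"])
    show "0 \<le> K / \<sigma>" using K \<sigma>_pos by simp
    fix \<phi> assume \<phi>: "\<phi> \<in> Cc_inf \<Omega>"
    note [measurable] = Cc_inf_borel[OF \<phi>]
    have van: "\<phi> x = 0" if "R \<le> norm x" for x
      using Cc_inf_vanishes[OF \<phi>, of x] R(2)[of x] that by fastforce
    have U: "\<phi> \<in> U_space \<Omega> A \<delta>" by (rule Cc_inf_subset_U_space[OF \<phi>])
    have cont: "continuous_on UNIV \<phi>" by (rule Cc_inf_continuous[OF \<phi>])
    define F where "F h x = indicator S h * ennreal ((\<phi> (x + h) - \<phi> x)\<^sup>2)" for h x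
    define E where "E z = indicator S (snd z - fst z) * ennreal ((\<phi> (snd z) - \<phi> (fst z))\<^sup>2)" for z
    have cF: "continuous_on UNIV (\<lambda>z :: (real ^ 'n) \<times> (real ^ 'n). (\<phi> (snd z + fst z) - \<phi> (snd z))\<^sup>2)"
      by (intro continuous_intros continuous_on_compose2[OF cont]) auto
    have fst_m: "(\<lambda>z :: (real ^ 'n) \<times> (real ^ 'n). fst z) \<in> borel_measurable borel"
      by (intro borel_measurable_continuous_onI continuous_intros)
    have Fm: "(\<lambda>z. F (fst z) (snd z)) \<in> borel_measurable borel"
      unfolding F_def
      by (intro borel_measurable_times_ennreal measurable_compose[OF fst_m] measurable_compose[OF _ measurable_ennreal]
          borel_measurable_indicator S_sets borel_measurable_continuous_onI[OF cF])
    have cE: "continuous_on UNIV (\<lambda>z :: (real ^ 'n) \<times> (real ^ 'n). (\<phi> (snd z) - \<phi> (fst z))\<^sup>2)"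
      by (intro continuous_intros continuous_on_compose2[OF cont]) auto
    have diff_m: "(\<lambda>z :: (real ^ 'n) \<times> (real ^ 'n). snd z - fst z) \<in> borel_measurable borel"
      by (intro borel_measurable_continuous_onI continuous_intros)
    have Em: "E \<in> borel_measurable borel"
      unfolding E_def
      by (intro borel_measurable_times_ennreal measurable_compose[OF diff_m] measurable_compose[OF _ measurable_ennreal]
          borel_measurable_indicator S_sets borel_measurable_continuous_onI[OF cE])
    \<comment> \<open>where the increment does not vanish, the kernel divided by \<open>t\<^sup>2\<close> is at least \<open>c / (\<delta> / 2)\<^sup>2\<close>\<close>
    have EM2: "E z \<le> ennreal ((\<delta> / 2)\<^sup>2 / c) * (ennreal ((dq \<phi> z)\<^sup>2) * indicator (D \<times> D) z)" for z
    proof (cases "snd z - fst z \<in> S \<and> \<phi> (snd z) \<noteq> \<phi> (fst z)")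
      case True
      define t where "t = norm (fst z - snd z)"
      have t: "0 < t" "t < \<delta> / 2"
        using S[of "snd z - fst z"] True horizon_pos by (auto simp: t_def norm_minus_commute)
      have "fst z \<in> \<Omega> \<or> snd z \<in> \<Omega>"
        using Cc_inf_vanishes[OF \<phi>, of "fst z"] Cc_inf_vanishes[OF \<phi>, of "snd z"] True by force
      then have D: "z \<in> D \<times> D"
        using t horizon_pos fattening_memI[of "fst z" "snd z"] fattening_memI[of "snd z" "fst z"] domain_subset
        by (cases z) (auto simp: t_def norm_minus_commute)
      have cA: "c \<le> A \<delta> t" using c(2)[of "fst z - snd z"] t by (auto simp: t_def)
      have dq: "(dq \<phi> z)\<^sup>2 = A \<delta> t * (\<phi> (fst z) - \<phi> (snd z))\<^sup>2 / t\<^sup>2"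
        using kernel_nonneg[of t] t by (simp add: dq_def t_def[symmetric] power_mult_distrib power_divide)
      have "c / (\<delta> / 2)\<^sup>2 \<le> A \<delta> t / t\<^sup>2"
        using cA t c(1) by (intro frac_le power_mono) auto
      then have "c / (\<delta> / 2)\<^sup>2 * (\<phi> (fst z) - \<phi> (snd z))\<^sup>2 \<le> A \<delta> t / t\<^sup>2 * (\<phi> (fst z) - \<phi> (snd z))\<^sup>2"
        by (rule mult_right_mono) simp
      then have "(\<delta> / 2)\<^sup>2 / c * (c / (\<delta> / 2)\<^sup>2 * (\<phi> (fst z) - \<phi> (snd z))\<^sup>2) \<le> (\<delta> / 2)\<^sup>2 / c * (dq \<phi> z)\<^sup>2"
        unfolding dq using c(1) by (intro mult_left_mono) auto
      then have "(\<phi> (snd z) - \<phi> (fst z))\<^sup>2 \<le> (\<delta> / 2)\<^sup>2 / c * (dq \<phi> z)\<^sup>2"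
        using c(1) horizon_pos by (simp add: power2_commute[of "\<phi> (snd z)"])
      then show ?thesis
        using True D c(1) by (auto simp: E_def indicator_def intro!: ennreal_leI simp flip: ennreal_mult')
    qed (auto simp: E_def)
    have "ennreal \<sigma> * (\<integral>\<^sup>+x. ennreal ((\<phi> x)\<^sup>2) \<partial>lborel)
       = (\<integral>\<^sup>+h. indicator S h * (\<integral>\<^sup>+x. ennreal ((\<phi> x)\<^sup>2) \<partial>lborel) \<partial>lborel)"
      by (simp add: nn_integral_multc \<sigma>)
    also have "\<dots> \<le> (\<integral>\<^sup>+h. ennreal ((real m)\<^sup>2) * (\<integral>\<^sup>+x. F h x \<partial>lborel) \<partial>lborel)"
    proof (intro nn_integral_mono)
      fix h
      show "indicator S h * (\<integral>\<^sup>+x. ennreal ((\<phi> x)\<^sup>2) \<partial>lborel) \<le> ennreal ((real m)\<^sup>2) * (\<integral>\<^sup>+x. F h x \<partial>lborel)"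
      proof (cases "h \<in> S")
        case True
        have "2 * R \<le> real m * (\<delta> / 4)" using m horizon_pos by (simp add: field_simps)
        also have "\<dots> \<le> real m * norm h" using S(1)[OF True] by (intro mult_left_mono) auto
        finally show ?thesis
          using translation_Poincare[of \<phi> R m h] van True by (simp add: F_def)
      qed simp
    qed
    also have "\<dots> = ennreal ((real m)\<^sup>2) * (\<integral>\<^sup>+h. \<integral>\<^sup>+x. F h x \<partial>lborel \<partial>lborel)"
    proof (rule nn_integral_cmult)
      show "(\<lambda>h. \<integral>\<^sup>+x. F h x \<partial>lborel) \<in> borel_measurable lborel"
        using lborel.borel_measurable_nn_integral_fst[of "\<lambda>z. F (fst z) (snd z)" lborel] Fm
        by (simp add: lborel_prod)
    qed
    also have "(\<integral>\<^sup>+h. \<integral>\<^sup>+x. F h x \<partial>lborel \<partial>lborel) = (\<integral>\<^sup>+x. \<integral>\<^sup>+h. F h x \<partial>lborel \<partial>lborel)"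
      using nn_integral_lborel_fst[OF Fm] nn_integral_lborel_snd[OF Fm] by simp
    also have "\<dots> = (\<integral>\<^sup>+x. \<integral>\<^sup>+y. E (x, y) \<partial>lborel \<partial>lborel)"
    proof (rule nn_integral_cong)
      fix x :: "real ^ 'n"
      have cx: "continuous_on UNIV (\<lambda>y. (\<phi> y - \<phi> x)\<^sup>2)"
        by (intro continuous_intros continuous_on_compose2[OF cont]) auto
      have cs: "(\<lambda>y. y - x) \<in> borel_measurable borel"
        by (intro borel_measurable_continuous_onI continuous_intros)
      have "(\<lambda>y. E (x, y)) \<in> borel_measurable borel"
        unfolding E_def fst_conv snd_conv
        by (intro borel_measurable_times_ennreal measurable_compose[OF cs] measurable_compose[OF _ measurable_ennreal]
          borel_measurable_indicator S_sets borel_measurable_continuous_onI[OF cx])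
      from nn_integral_lborel_shift[OF this, of x]
      show "(\<integral>\<^sup>+h. F h x \<partial>lborel) = (\<integral>\<^sup>+y. E (x, y) \<partial>lborel)"
        by (simp add: E_def F_def add.commute)
    qed
    also have "\<dots> = (\<integral>\<^sup>+z. E z \<partial>lborel)" by (rule nn_integral_lborel_fst[OF Em])
    also have "\<dots> = (\<integral>\<^sup>+z. E z \<partial>lebesgue)" by (simp add: nn_integral_completion)
    also have "\<dots> \<le> (\<integral>\<^sup>+z. ennreal ((\<delta> / 2)\<^sup>2 / c) * (ennreal ((dq \<phi> z)\<^sup>2) * indicator (D \<times> D) z) \<partial>lebesgue)"
      by (intro nn_integral_mono EM2)
    also have "\<dots> = ennreal ((\<delta> / 2)\<^sup>2 / c) * (\<integral>\<^sup>+z. ennreal ((dq \<phi> z)\<^sup>2) * indicator (D \<times> D) z \<partial>lebesgue)"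
    proof (rule nn_integral_cmult)
      have "(\<lambda>z. ennreal ((dq \<phi> z)\<^sup>2)) \<in> borel_measurable M2"
        using U by (auto simp: U_space_iff square_integrable_def)
      then show "(\<lambda>z. ennreal ((dq \<phi> z)\<^sup>2) * indicator (D \<times> D) z) \<in> borel_measurable lebesgue"
        by (subst (asm) borel_measurable_restrict_space_iff_ennreal) auto
    qed
    also have "(\<integral>\<^sup>+z. ennreal ((dq \<phi> z)\<^sup>2) * indicator (D \<times> D) z \<partial>lebesgue) = (\<integral>\<^sup>+z. ennreal ((dq \<phi> z)\<^sup>2) \<partial>M2)"
      by (subst nn_integral_restrict_space) auto
    also have "\<dots> = ennreal (energy \<phi>)"
      unfolding energy_eq using U by (intro nn_integral_eq_integral) (auto simp: U_space_iff square_integrable_def)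
    also have "ennreal ((real m)\<^sup>2) * (ennreal ((\<delta> / 2)\<^sup>2 / c) * ennreal (energy \<phi>)) = ennreal (K * energy \<phi>)"
    proof -
      have "0 \<le> (\<delta> / 2)\<^sup>2 / c" using c(1) by simp
      then show ?thesis unfolding K_def by (simp only: ennreal_mult' mult.assoc zero_le_power2)
    qed
    finally have le: "ennreal \<sigma> * (\<integral>\<^sup>+x. ennreal ((\<phi> x)\<^sup>2) \<partial>lborel) \<le> ennreal (K * energy \<phi>)"
      by (simp add: mult_left_mono)
    have "(\<integral>\<^sup>+x. ennreal ((\<phi> x)\<^sup>2) \<partial>lborel) = (\<integral>\<^sup>+x. ennreal ((\<phi> x)\<^sup>2) \<partial>M)"
    proof -
      have "(\<integral>\<^sup>+x. ennreal ((\<phi> x)\<^sup>2) \<partial>M) = (\<integral>\<^sup>+x. ennreal ((\<phi> x)\<^sup>2) * indicator D x \<partial>lborel)"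
        by (subst nn_integral_restrict_space) (auto simp: nn_integral_completion)
      also have "\<dots> = (\<integral>\<^sup>+x. ennreal ((\<phi> x)\<^sup>2) \<partial>lborel)"
        using Cc_inf_vanishes[OF \<phi>] domain_subset
        by (intro nn_integral_cong) (auto simp: indicator_def)
      finally show ?thesis by simp
    qed
    also have "\<dots> = ennreal (LINT x|M. (\<phi> x)\<^sup>2)"
      using U by (intro nn_integral_eq_integral) (auto simp: U_space_iff square_integrable_def)
    finally have eq: "(\<integral>\<^sup>+x. ennreal ((\<phi> x)\<^sup>2) \<partial>lborel) = ennreal (LINT x|M. (\<phi> x)\<^sup>2)" .
    have "\<sigma> * (LINT x|M. (\<phi> x)\<^sup>2) \<le> K * energy \<phi>"
      using le[unfolded eq] \<sigma>_pos K energy_nonneg[of \<phi>] by (simp flip: ennreal_mult')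
    then show "(LINT x|M. (\<phi> x)\<^sup>2) \<le> K / \<sigma> * energy \<phi>"
      using \<sigma>_pos by (simp add: field_simps)
  qed
qed

end

section \<open>The state equation\<close>

context nonlocal_kernel
begin

lemma load_integrable:
  assumes "f \<in> L2_on \<Omega>" "v \<in> U_space \<Omega> A \<delta>"
  shows "integrable (lebesgue_on \<Omega>) (\<lambda>x. f x * v x)"
proof (rule square_integrable_mult)
  show "f \<in> square_integrable (lebesgue_on \<Omega>)" using assms(1) by (simp add: L2_on_eq)
  have "v \<in> square_integrable M" using assms(2) by (simp add: U_space_iff)
  then show "v \<in> square_integrable (lebesgue_on \<Omega>)"
    by (rule square_integrable_subset(1)) (simp_all add: domain_subset)
qed

lemma load_comb:
  assumes "f \<in> L2_on \<Omega>" "u \<in> U_space \<Omega> A \<delta>" "v \<in> U_space \<Omega> A \<delta>"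
  shows "load \<Omega> f (\<lambda>x. u x + c * v x) = load \<Omega> f u + c * load \<Omega> f v"
proof -
  have "load \<Omega> f u + c * load \<Omega> f v = (LINT x|lebesgue_on \<Omega>. f x * u x + c * (f x * v x))"
    unfolding load_def using load_integrable[OF assms(1,2)] load_integrable[OF assms(1,3)] by simp
  then show ?thesis by (simp add: load_def algebra_simps)
qed

lemma load_bound:
  assumes "f \<in> L2_on \<Omega>" "v \<in> U_space \<Omega> A \<delta>"
  shows "(load \<Omega> f v)\<^sup>2 \<le> (LINT x|lebesgue_on \<Omega>. (f x)\<^sup>2) * (LINT x|M. (v x)\<^sup>2)"
proof -
  have v: "v \<in> square_integrable M" using assms(2) by (simp add: U_space_iff)
  note sub = square_integrable_subset[OF v domain_subset domain_sets(2) fattening_sets(2)]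
  have "(load \<Omega> f v)\<^sup>2 \<le> (LINT x|lebesgue_on \<Omega>. (f x)\<^sup>2) * (LINT x|lebesgue_on \<Omega>. (v x)\<^sup>2)"
    using integral_Cauchy_Schwarz[of f "lebesgue_on \<Omega>" v] sub(1) assms(1)
    by (simp add: load_def L2_on_eq power2_eq_square)
  also have "\<dots> \<le> (LINT x|lebesgue_on \<Omega>. (f x)\<^sup>2) * (LINT x|M. (v x)\<^sup>2)"
    by (intro mult_left_mono sub(2)) simp
  finally show ?thesis .
qed

lemma U_norm_square: "(U_norm \<Omega> A \<delta> u)\<^sup>2 = (LINT x|M. (u x)\<^sup>2) + energy u"
  using energy_nonneg[of u] by (simp add: U_norm_def)

lemma U0_space_subset: "U0_space \<Omega> A \<delta> \<subseteq> U_space \<Omega> A \<delta>"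
  by (auto simp: U0_space_def)

lemma U0_space_approx:
  assumes "v \<in> U0_space \<Omega> A \<delta>"
  obtains \<phi> where "\<And>j. \<phi> j \<in> Cc_inf \<Omega>"
    and "\<And>j. (LINT x|M. (v x - \<phi> j x)\<^sup>2) + energy (\<lambda>x. v x - \<phi> j x) \<le> 1 / 4 ^ j"
proof -
  define P where "P j \<phi> \<longleftrightarrow> \<phi> \<in> Cc_inf \<Omega> \<and>
    (LINT x|M. (v x - \<phi> x)\<^sup>2) + energy (\<lambda>x. v x - \<phi> x) \<le> 1 / 4 ^ j" for j :: nat and \<phi>
  have "\<exists>\<phi>. P j \<phi>" for j
  proof -
    have "0 < (1 / 2 :: real) ^ j" by simp
    then obtain \<phi> where \<phi>: "\<phi> \<in> Cc_inf \<Omega>" "U_norm \<Omega> A \<delta> (\<lambda>x. v x - \<phi> x) < (1 / 2) ^ j"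
      using assms unfolding U0_space_def by blast
    have "0 \<le> U_norm \<Omega> A \<delta> (\<lambda>x. v x - \<phi> x)"
      using energy_nonneg by (simp add: U_norm_def)
    then have "(U_norm \<Omega> A \<delta> (\<lambda>x. v x - \<phi> x))\<^sup>2 \<le> ((1 / 2) ^ j)\<^sup>2"
      using \<phi>(2) by (intro power_mono) auto
    also have "((1 / 2 :: real) ^ j)\<^sup>2 = ((1 / 2)\<^sup>2) ^ j"
      by (simp only: mult.commute flip: power_mult)
    also have "\<dots> = 1 / 4 ^ j"
      by (simp add: power_divide)
    finally show ?thesis
      using \<phi>(1) unfolding P_def U_norm_square by blast
  qed
  then obtain \<phi> where "\<And>j. P j (\<phi> j)" using choice[of P] by blast
  then show ?thesis
    by (intro that[of \<phi>]) (simp_all add: P_def)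
qed

text \<open>
  The Riesz representation theorem in the energy space. The minimising sequence is taken among the test
  functions, so that its limit lies in their closure by construction and the Poincare inequality is
  needed for test functions only.
\<close>

lemma exists_solution:
  assumes \<kappa>: "elliptic \<kappa> a b" and f: "f \<in> L2_on \<Omega>"
  obtains u where "u \<in> U0_space \<Omega> A \<delta>" "\<And>v. v \<in> U0_space \<Omega> A \<delta> \<Longrightarrow> form \<kappa> u v = load \<Omega> f v"
proof -
  interpret U: nonneg_form "U_space \<Omega> A \<delta>" "form \<kappa>"
    by (rule form_nonneg_form[OF \<kappa>])
  have sub: "Cc_inf \<Omega> \<subseteq> U_space \<Omega> A \<delta>" using Cc_inf_subset_U_space by blast
  interpret V: nonneg_form "Cc_inf \<Omega>" "form \<kappa>"
  proof
    show "Cc_inf \<Omega> \<noteq> {}" using zero_in_Cc_inf[of \<Omega>] by blast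
  qed (use sub in \<open>simp_all add: Cc_inf_comb U.lin U.nonneg U.sym subsetD\<close>)
  obtain C where C: "0 \<le> C" "\<And>\<phi>. \<phi> \<in> Cc_inf \<Omega> \<Longrightarrow> (LINT x|M. (\<phi> x)\<^sup>2) \<le> C * energy \<phi>"
    by (rule nonlocal_Poincare) blast
  have a: "0 < a" using \<kappa> by (simp add: elliptic_def)
  have energy_le: "energy u \<le> form \<kappa> u u / a" if "u \<in> U_space \<Omega> A \<delta>" for u
    using form_bounds(1)[OF \<kappa> that] a by (simp add: field_simps)
  define K where "K = (LINT x|lebesgue_on \<Omega>. (f x)\<^sup>2)"
  have K: "0 \<le> K" by (simp add: K_def)
  have lb: "(load \<Omega> f \<phi>)\<^sup>2 \<le> K * C / a * form \<kappa> \<phi> \<phi>" if \<phi>: "\<phi> \<in> Cc_inf \<Omega>" for \<phi>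
  proof -
    have "(load \<Omega> f \<phi>)\<^sup>2 \<le> K * (LINT x|M. (\<phi> x)\<^sup>2)"
      unfolding K_def using \<phi> sub by (intro load_bound f) auto
    also have "\<dots> \<le> K * (C * (form \<kappa> \<phi> \<phi> / a))"
      using C(2)[OF \<phi>] energy_le[of \<phi>] \<phi> sub C(1) K
      by (intro mult_left_mono order_trans[OF C(2)[OF \<phi>]]) auto
    finally show ?thesis by simp
  qed
  obtain \<phi> where \<phi>: "\<And>j. \<phi> j \<in> Cc_inf \<Omega>"
    and fast: "\<And>i j. i \<le> j \<Longrightarrow> form \<kappa> (\<lambda>x. \<phi> j x - \<phi> i x) (\<lambda>x. \<phi> j x - \<phi> i x) \<le> 1 / 4 ^ i"
    and lim: "\<And>\<psi>. \<psi> \<in> Cc_inf \<Omega> \<Longrightarrow> (\<lambda>j. form \<kappa> (\<phi> j) \<psi>) \<longlonglongrightarrow> load \<Omega> f \<psi>"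
    using V.Riesz_minimizing_sequence[OF load_comb[OF f subsetD[OF sub] subsetD[OF sub]] lb] by blast
  have \<phi>U: "\<phi> j \<in> U_space \<Omega> A \<delta>" for j using \<phi> sub by auto
  have en: "energy (\<lambda>x. \<phi> j x - \<phi> i x) \<le> (1 / a) / 4 ^ i" if "i \<le> j" for i j
    using energy_le[OF U.diff[OF \<phi>U \<phi>U], of j i] fast[OF that] a
    by (intro order_trans[OF energy_le[OF U.diff[OF \<phi>U \<phi>U]]]) (simp add: field_simps)
  have l2: "(LINT x|M. (\<phi> j x - \<phi> i x)\<^sup>2) \<le> (C / a) / 4 ^ i" if "i \<le> j" for i j
    using mult_left_mono[OF en[OF that] C(1)] C(2)[OF V.diff[OF \<phi> \<phi>], of j i] by simp
  have \<phi>sq: "\<phi> j \<in> square_integrable M" for j using \<phi>U by (simp add: U_space_iff)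
  obtain u where u: "u \<in> square_integrable M"
    and uAE: "AE x in M. (\<lambda>j. \<phi> j x) \<longlonglongrightarrow> u x"
    and ul2: "\<And>i. (LINT x|M. (u x - \<phi> i x)\<^sup>2) \<le> (C / a) / 4 ^ i"
    using square_integrable_Cauchy_limit[OF \<phi>sq l2] by blast
  have um: "u \<in> borel_measurable M" using u by (simp add: square_integrable_def)
  \<comment> \<open>convergence almost everywhere on \<open>D\<close> gives that of the difference quotients on \<open>D \<times> D\<close>\<close>
  have dqAE: "AE z in M2. (\<lambda>j. dq (\<phi> j) z) \<longlonglongrightarrow> dq u z"
    using fst_AE_on[OF uAE] snd_AE_on[OF uAE]
  proof eventually_elim
    case (elim z)
    then show ?case unfolding dq_def divide_inverse by (intro tendsto_intros)
  qed
  have d: "dq (\<lambda>x. u x - \<phi> i x) \<in> square_integrable M2"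
          "energy (\<lambda>x. u x - \<phi> i x) \<le> (1 / a) / 4 ^ i" for i
  proof -
    have 1: "dq (\<lambda>x. \<phi> j x - \<phi> i x) \<in> square_integrable M2" for j
      using U.diff[OF \<phi>U \<phi>U] by (simp add: U_space_iff)
    have 2: "AE z in M2. (\<lambda>j. dq (\<lambda>x. \<phi> j x - \<phi> i x) z) \<longlonglongrightarrow> dq (\<lambda>x. u x - \<phi> i x) z"
      using dqAE by eventually_elim (auto simp: dq_diff intro!: tendsto_intros)
    have 3: "dq (\<lambda>x. u x - \<phi> i x) \<in> borel_measurable M2"
      using square_integrable_diff[OF u \<phi>sq] by (intro dq_measurable) (auto simp: square_integrable_def)
    have 4: "eventually (\<lambda>j. (LINT z|M2. (dq (\<lambda>x. \<phi> j x - \<phi> i x) z)\<^sup>2) \<le> (1 / a) / 4 ^ i) sequentially"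
      using en eventually_sequentially unfolding energy_eq by blast
    from square_integrable_Fatou[OF 1 2 3 4]
    show "dq (\<lambda>x. u x - \<phi> i x) \<in> square_integrable M2" "energy (\<lambda>x. u x - \<phi> i x) \<le> (1 / a) / 4 ^ i"
      by (simp_all add: energy_eq)
  qed
  have du: "(\<lambda>x. u x - \<phi> i x) \<in> U_space \<Omega> A \<delta>" for i
    using d(1) square_integrable_diff[OF u \<phi>sq] by (simp add: U_space_iff)
  have uU: "u \<in> U_space \<Omega> A \<delta>"
    using U.comb[OF du[of 0] \<phi>U[of 0], of 1] by simp
  have u0: "u \<in> U0_space \<Omega> A \<delta>"
  proof -
    have "\<exists>\<psi>\<in>Cc_inf \<Omega>. U_norm \<Omega> A \<delta> (\<lambda>x. u x - \<psi> x) < e" if e: "0 < e" for e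
    proof -
      have "(\<lambda>i. U_norm \<Omega> A \<delta> (\<lambda>x. u x - \<phi> i x)) \<longlonglongrightarrow> 0"
      proof (rule tendsto_0_if_square_le)
        fix i
        have "(U_norm \<Omega> A \<delta> (\<lambda>x. u x - \<phi> i x))\<^sup>2 \<le> (C / a) / 4 ^ i + (1 / a) / 4 ^ i"
          unfolding U_norm_square by (rule add_mono[OF ul2 d(2)])
        then show "(U_norm \<Omega> A \<delta> (\<lambda>x. u x - \<phi> i x))\<^sup>2 \<le> 1 / 4 ^ i * (C / a + 1 / a)"
          by (simp add: add_divide_distrib)
      qed (rule inverse_power4_tendsto_0)
      from order_tendstoD(2)[OF this e] show ?thesis
        using \<phi> by (auto simp: eventually_sequentially)
    qed
    then show ?thesis using uU by (auto simp: U0_space_def)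
  qed
  \<comment> \<open>the equation holds for test functions, and both sides are continuous in the energy norm\<close>
  have test: "form \<kappa> u \<psi> = load \<Omega> f \<psi>" if \<psi>: "\<psi> \<in> Cc_inf \<Omega>" for \<psi>
  proof -
    have \<psi>U: "\<psi> \<in> U_space \<Omega> A \<delta>" using \<psi> sub by auto
    have b: "0 \<le> \<bar>b\<bar>" by simp
    have "(\<lambda>j. form \<kappa> u \<psi> - form \<kappa> (\<phi> j) \<psi>) \<longlonglongrightarrow> 0"
    proof (rule tendsto_0_if_square_le)
      fix j
      have "(form \<kappa> u \<psi> - form \<kappa> (\<phi> j) \<psi>)\<^sup>2 = (form \<kappa> (\<lambda>x. u x - \<phi> j x) \<psi>)\<^sup>2"
        by (simp add: U.lin_diff[OF uU \<phi>U \<psi>U])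
      also have "\<dots> \<le> form \<kappa> (\<lambda>x. u x - \<phi> j x) (\<lambda>x. u x - \<phi> j x) * form \<kappa> \<psi> \<psi>"
        by (rule U.Cauchy_Schwarz[OF du \<psi>U])
      also have "\<dots> \<le> (\<bar>b\<bar> * ((1 / a) / 4 ^ j)) * form \<kappa> \<psi> \<psi>"
      proof (rule mult_right_mono[OF _ U.nonneg[OF \<psi>U]])
        have "form \<kappa> (\<lambda>x. u x - \<phi> j x) (\<lambda>x. u x - \<phi> j x) \<le> b * energy (\<lambda>x. u x - \<phi> j x)"
          by (rule form_bounds(2)[OF \<kappa> du])
        also have "\<dots> \<le> \<bar>b\<bar> * energy (\<lambda>x. u x - \<phi> j x)"
          by (intro mult_right_mono energy_nonneg) simp
        also have "\<dots> \<le> \<bar>b\<bar> * ((1 / a) / 4 ^ j)"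
          by (intro mult_left_mono d(2)) simp
        finally show "form \<kappa> (\<lambda>x. u x - \<phi> j x) (\<lambda>x. u x - \<phi> j x) \<le> \<bar>b\<bar> * ((1 / a) / 4 ^ j)" .
      qed
      finally show "(form \<kappa> u \<psi> - form \<kappa> (\<phi> j) \<psi>)\<^sup>2 \<le> 1 / 4 ^ j * (\<bar>b\<bar> / a * form \<kappa> \<psi> \<psi>)"
        by (simp add: field_simps)
    qed (rule inverse_power4_tendsto_0)
    moreover have "(\<lambda>j. form \<kappa> u \<psi> - form \<kappa> (\<phi> j) \<psi>) \<longlonglongrightarrow> form \<kappa> u \<psi> - load \<Omega> f \<psi>"
      by (rule tendsto_diff[OF tendsto_const lim[OF \<psi>]])
    ultimately show ?thesis using LIMSEQ_unique by fastforce
  qed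
  have "form \<kappa> u v = load \<Omega> f v" if v: "v \<in> U0_space \<Omega> A \<delta>" for v
  proof -
    have vU: "v \<in> U_space \<Omega> A \<delta>" using v U0_space_subset by auto
    obtain \<psi> where \<psi>: "\<And>j. \<psi> j \<in> Cc_inf \<Omega>"
      and close: "\<And>j. (LINT x|M. (v x - \<psi> j x)\<^sup>2) + energy (\<lambda>x. v x - \<psi> j x) \<le> 1 / 4 ^ j"
      using U0_space_approx[OF v] by blast
    have \<psi>U: "\<psi> j \<in> U_space \<Omega> A \<delta>" for j using \<psi> sub by auto
    define w where "w j = (\<lambda>x. v x - \<psi> j x)" for j
    have w: "w j \<in> U_space \<Omega> A \<delta>" for j unfolding w_def by (rule U.diff[OF vU \<psi>U])
    have wl2: "(LINT x|M. (w j x)\<^sup>2) \<le> 1 / 4 ^ j" and wen: "energy (w j) \<le> 1 / 4 ^ j" for j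
    proof -
      have "0 \<le> (LINT x|M. (w j x)\<^sup>2)" by simp
      with close[of j] energy_nonneg[of "w j"]
      show "(LINT x|M. (w j x)\<^sup>2) \<le> 1 / 4 ^ j" "energy (w j) \<le> 1 / 4 ^ j"
        unfolding w_def by linarith+
    qed
    have "(\<lambda>j. form \<kappa> u (w j)) \<longlonglongrightarrow> 0"
    proof (rule tendsto_0_if_square_le)
      fix j
      have "(form \<kappa> u (w j))\<^sup>2 \<le> form \<kappa> u u * form \<kappa> (w j) (w j)"
        by (rule U.Cauchy_Schwarz[OF uU w])
      also have "\<dots> \<le> form \<kappa> u u * (\<bar>b\<bar> * (1 / 4 ^ j))"
      proof (rule mult_left_mono[OF _ U.nonneg[OF uU]])
        have "form \<kappa> (w j) (w j) \<le> b * energy (w j)" by (rule form_bounds(2)[OF \<kappa> w])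
        also have "\<dots> \<le> \<bar>b\<bar> * energy (w j)" by (intro mult_right_mono energy_nonneg) simp
        also have "\<dots> \<le> \<bar>b\<bar> * (1 / 4 ^ j)" by (intro mult_left_mono wen) simp
        finally show "form \<kappa> (w j) (w j) \<le> \<bar>b\<bar> * (1 / 4 ^ j)" .
      qed
      finally show "(form \<kappa> u (w j))\<^sup>2 \<le> 1 / 4 ^ j * (form \<kappa> u u * \<bar>b\<bar>)" by (simp add: field_simps)
    qed (rule inverse_power4_tendsto_0)
    moreover have "(\<lambda>j. load \<Omega> f (w j)) \<longlonglongrightarrow> 0"
    proof (rule tendsto_0_if_square_le)
      show "(load \<Omega> f (w j))\<^sup>2 \<le> 1 / 4 ^ j * K" for j
        using order_trans[OF load_bound[OF f w] mult_left_mono[OF wl2 K[unfolded K_def]]]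
        by (simp add: K_def)
    qed (rule inverse_power4_tendsto_0)
    ultimately have "(\<lambda>j. form \<kappa> u (w j) - load \<Omega> f (w j)) \<longlonglongrightarrow> 0 - 0"
      by (rule tendsto_diff)
    moreover have "form \<kappa> u (w j) - load \<Omega> f (w j) = form \<kappa> u v - load \<Omega> f v" for j
    proof -
      have "form \<kappa> u (w j) = form \<kappa> u v - form \<kappa> u (\<psi> j)"
        using U.sym[OF uU] U.lin_diff[OF vU \<psi>U uU] vU \<psi>U w by (simp add: w_def)
      moreover have "load \<Omega> f (w j) = load \<Omega> f v - load \<Omega> f (\<psi> j)"
        using load_comb[OF f vU \<psi>U, of "-1"] by (simp add: w_def)
      ultimately show ?thesis using test[OF \<psi>] by simp
    qed
    ultimately show ?thesis by (simp add: LIMSEQ_const_iff)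
  qed
  then show ?thesis using that u0 by blast
qed

end

section \<open>Optimal designs\<close>

context nonlocal_kernel
begin

abbreviation design_coeff :: "real \<Rightarrow> (real ^ 'n \<Rightarrow> real) \<Rightarrow> real ^ 'n \<Rightarrow> real ^ 'n \<Rightarrow> real" where
  "design_coeff p \<rho> \<equiv> \<lambda>x x'. \<rho> x powr (p / 2) * \<rho> x' powr (p / 2)"

lemma admissible_powr_bounds:
  assumes \<rho>: "\<rho> \<in> admissible \<Omega> \<delta> \<rho>min \<rho>max \<gamma>" and "0 < \<rho>min" "0 < p"
  shows "(\<lambda>x. \<rho> x powr (p / 2)) \<in> borel_measurable M"
    and "AE x in M. \<rho>min powr (p / 2) \<le> \<rho> x powr (p / 2) \<and> \<rho> x powr (p / 2) \<le> \<rho>max powr (p / 2)"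
proof -
  have m: "\<rho> \<in> borel_measurable M" and AE: "AE x in M. \<rho>min \<le> \<rho> x \<and> \<rho> x \<le> \<rho>max"
    using \<rho> by (auto simp: admissible_def Linf_on_def)
  show "(\<lambda>x. \<rho> x powr (p / 2)) \<in> borel_measurable M"
    using m by measurable
  show "AE x in M. \<rho>min powr (p / 2) \<le> \<rho> x powr (p / 2) \<and> \<rho> x powr (p / 2) \<le> \<rho>max powr (p / 2)"
    using AE by eventually_elim (use assms in \<open>auto intro!: powr_mono2\<close>)
qed

lemma elliptic_design_coeff:
  assumes \<rho>: "\<rho> \<in> admissible \<Omega> \<delta> \<rho>min \<rho>max \<gamma>" and "0 < \<rho>min" "0 < p"
  shows "elliptic (design_coeff p \<rho>) (\<rho>min powr (p / 2) * \<rho>min powr (p / 2)) (\<rho>max powr (p / 2) * \<rho>max powr (p / 2))"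
proof -
  note m = admissible_powr_bounds(1)[OF assms] and AE = admissible_powr_bounds(2)[OF assms]
  have "AE z in M2. \<rho>min powr (p / 2) * \<rho>min powr (p / 2) \<le> design_coeff p \<rho> (fst z) (snd z) \<and>
     design_coeff p \<rho> (fst z) (snd z) \<le> \<rho>max powr (p / 2) * \<rho>max powr (p / 2)"
    using fst_AE_on[OF AE] snd_AE_on[OF AE] by eventually_elim (auto intro!: mult_mono)
  then show ?thesis
    unfolding elliptic_def using assms(2)
    by (auto intro!: borel_measurable_times fst_measurable_on[OF m] snd_measurable_on[OF m])
qed

lemma constant_admissible:
  assumes "0 < \<rho>min" "\<rho>min \<le> \<rho>max" "\<rho>min \<le> \<gamma>"
  shows "(\<lambda>_. \<rho>min) \<in> admissible \<Omega> \<delta> \<rho>min \<rho>max \<gamma>"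
proof -
  have "(LINT x|lebesgue_on \<Omega>. \<rho>min) = \<rho>min * measure lebesgue \<Omega>"
    by (simp add: measure_restrict_space space_restrict_space)
  also have "\<dots> \<le> \<gamma> * measure lebesgue \<Omega>"
    using assms by (intro mult_right_mono) auto
  finally show ?thesis
    using assms by (auto simp: admissible_def Linf_on_def)
qed

lemma integral_domain_eq: "(LINT x|lebesgue_on \<Omega>. h x) = (LINT x|M. indicator \<Omega> x * h x)" for h :: "real ^ 'n \<Rightarrow> real"
proof -
  have "(LINT x|M. indicator \<Omega> x * h x) = (LINT x|lebesgue. indicator D x *\<^sub>R (indicator \<Omega> x * h x))"
    by (subst integral_restrict_space) auto
  also have "\<dots> = (LINT x|lebesgue. indicator \<Omega> x *\<^sub>R h x)"
    using domain_subset by (intro Bochner_Integration.integral_cong) (auto simp: indicator_def)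
  also have "\<dots> = (LINT x|lebesgue_on \<Omega>. h x)"
    by (subst integral_restrict_space) auto
  finally show ?thesis by simp
qed

text \<open>
  Expand \<open>form \<kappa> (u - w) (u - w) \<ge> 0\<close> and insert the equation for \<open>u\<close>.
\<close>

lemma compliance_lower_bound:
  assumes \<kappa>: "elliptic \<kappa> a b" and u: "u \<in> U0_space \<Omega> A \<delta>"
    and sol: "\<And>v. v \<in> U0_space \<Omega> A \<delta> \<Longrightarrow> form \<kappa> u v = load \<Omega> f v"
    and w: "w \<in> U0_space \<Omega> A \<delta>"
  shows "2 * load \<Omega> f w - form \<kappa> w w \<le> load \<Omega> f u"
proof -
  interpret U: nonneg_form "U_space \<Omega> A \<delta>" "form \<kappa>"
    by (rule form_nonneg_form[OF \<kappa>])
  have "u \<in> U_space \<Omega> A \<delta>" "w \<in> U_space \<Omega> A \<delta>" using u w U0_space_subset by auto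
  then have "0 \<le> form \<kappa> u u - 2 * form \<kappa> u w + form \<kappa> w w"
    using U.quadratic_diff[of u w] U.nonneg[OF U.diff[of u w]] by simp
  then show ?thesis using sol[OF u] sol[OF w] by simp
qed

text \<open>
  The direct argument. The state \<open>u\<close> of the limit design serves as the fixed test function \<open>w\<close> in
  \<open>compliance_lower_bound\<close>, and thus no convergence of the states \<open>u\<^sub>j\<close> has to be established.
\<close>

lemma exists_optimal_design:
  assumes bounds: "0 < \<rho>min" "\<rho>min \<le> \<rho>max" "\<rho>min \<le> \<gamma>" and p: "0 < p" "p \<le> 2" and f: "f \<in> L2_on \<Omega>"
  shows "\<exists>\<rho> u. optimal \<Omega> A \<delta> \<rho>min \<rho>max \<gamma> p f \<rho> u"
proof -
  let ?Adm = "admissible \<Omega> \<delta> \<rho>min \<rho>max \<gamma>" and ?U0 = "U0_space \<Omega> A \<delta>"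
  define Fs where "Fs = feasible \<Omega> A \<delta> \<rho>min \<rho>max \<gamma> p f"
  define a where "a = \<rho>min powr (p / 2)"
  define b where "b = \<rho>max powr (p / 2)"
  have a: "0 < a" using bounds by (simp add: a_def)
  have ab: "a \<le> b" unfolding a_def b_def using bounds p by (intro powr_mono2) auto
  have Fs_iff: "(\<rho>, u) \<in> Fs \<longleftrightarrow> \<rho> \<in> ?Adm \<and> u \<in> ?U0 \<and>
      (\<forall>v\<in>?U0. form (design_coeff p \<rho>) u v = load \<Omega> f v)" for \<rho> u
    by (simp add: Fs_def feasible_def)
  have ell: "elliptic (design_coeff p \<rho>) (a * a) (b * b)" if "\<rho> \<in> ?Adm" for \<rho>
    unfolding a_def b_def by (rule elliptic_design_coeff[OF that bounds(1) p(1)])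
  have state: "\<exists>u. (\<rho>, u) \<in> Fs" if \<rho>: "\<rho> \<in> ?Adm" for \<rho>
  proof -
    obtain u where "u \<in> ?U0" "\<And>v. v \<in> ?U0 \<Longrightarrow> form (design_coeff p \<rho>) u v = load \<Omega> f v"
      by (rule exists_solution[OF ell[OF \<rho>] f]) (rule that)
    then show ?thesis using \<rho> unfolding Fs_iff by blast
  qed
  have lower: "2 * load \<Omega> f w - form (design_coeff p \<rho>) w w \<le> load \<Omega> f u"
    if "(\<rho>, u) \<in> Fs" "w \<in> ?U0" for \<rho> u w
    using that unfolding Fs_iff by (intro compliance_lower_bound[OF ell]) auto
  have nonneg: "0 \<le> load \<Omega> f u" if "(\<rho>, u) \<in> Fs" for \<rho> u
  proof -
    have "load \<Omega> f u = form (design_coeff p \<rho>) u u" "u \<in> U_space \<Omega> A \<delta>" "\<rho> \<in> ?Adm"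
      using that U0_space_subset unfolding Fs_iff by auto
    then show ?thesis using nonneg_form.nonneg[OF form_nonneg_form[OF ell]] by simp
  qed
  define J where "J = (\<lambda>(\<rho> :: real ^ 'n \<Rightarrow> real, u). load \<Omega> f u) ` Fs"
  define m where "m = Inf J"
  have "Fs \<noteq> {}" using state[OF constant_admissible[OF bounds]] by blast
  then have J: "J \<noteq> {}" "bdd_below J"
    using nonneg by (auto simp: J_def intro!: bdd_belowI2[of _ 0])
  have m_le: "m \<le> load \<Omega> f u" if "(\<rho>, u) \<in> Fs" for \<rho> u
    unfolding m_def using that J(2) by (intro cInf_lower) (force simp: J_def)+
  have "\<exists>x. x \<in> Fs \<and> load \<Omega> f (snd x) < m + 1 / real (Suc j)" for j
  proof -
    have "Inf J < m + 1 / real (Suc j)" by (simp add: m_def)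
    from cInf_lessD[OF J(1) this] show ?thesis unfolding J_def by force
  qed
  then have "\<forall>j. \<exists>x. x \<in> Fs \<and> load \<Omega> f (snd x) < m + 1 / real (Suc j)" by blast
  from choice[OF this] obtain X where X: "\<And>j. X j \<in> Fs" "\<And>j. load \<Omega> f (snd (X j)) < m + 1 / real (Suc j)"
    by blast
  define \<rho>s where "\<rho>s j = fst (X j)" for j
  define us where "us j = snd (X j)" for j
  have Xs: "(\<rho>s j, us j) \<in> Fs" and Jus: "load \<Omega> f (us j) < m + 1 / real (Suc j)" for j
    using X[of j] by (simp_all add: \<rho>s_def us_def)
  have adm: "\<rho>s j \<in> ?Adm" for j using Xs by (simp add: Fs_iff)
  have Jlim: "(\<lambda>j. load \<Omega> f (us j)) \<longlonglongrightarrow> m"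
  proof (rule tendsto_sandwich[OF _ _ tendsto_const])
    show "\<forall>\<^sub>F j in sequentially. m \<le> load \<Omega> f (us j)" using m_le[OF Xs] by simp
    show "\<forall>\<^sub>F j in sequentially. load \<Omega> f (us j) \<le> m + 1 / real (Suc j)"
      by (intro always_eventually allI less_imp_le Jus)
    show "(\<lambda>j. m + 1 / real (Suc j)) \<longlonglongrightarrow> m"
      using tendsto_add[OF tendsto_const LIMSEQ_inverse_real_of_nat, of m] by (simp add: inverse_eq_divide)
  qed

  have "\<exists>g. g \<in> borel_measurable borel \<and> (AE x in M. \<rho>s j x powr (p / 2) = g x) \<and> (\<forall>x. a \<le> g x \<and> g x \<le> b)" for j
    unfolding a_def b_def
    by (rule clamped_borel_version[OF admissible_powr_bounds(1)[OF adm bounds(1) p(1)] fattening_sets(2)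
        admissible_powr_bounds(2)[OF adm bounds(1) p(1)] ab[unfolded a_def b_def], of j]) blast
  then have "\<forall>j. \<exists>g. g \<in> borel_measurable borel \<and> (AE x in M. \<rho>s j x powr (p / 2) = g x) \<and> (\<forall>x. a \<le> g x \<and> g x \<le> b)"
    by blast
  from choice[OF this] obtain \<eta> where \<eta>: "\<And>j. \<eta> j \<in> borel_measurable borel"
    and \<eta>AE: "\<And>j. AE x in M. \<rho>s j x powr (p / 2) = \<eta> j x"
    and \<eta>b: "\<And>j x. a \<le> \<eta> j x" "\<And>j x. \<eta> j x \<le> b"
    by blast
  \<comment> \<open>\<open>M\<close> on Borel sets only: the square of this measure is \<open>M2\<close> on Borel sets\<close>
  define N where "N = density lborel (indicator D :: _ \<Rightarrow> ennreal)"
  have N_sets [measurable_cong]: "sets N = sets borel" by (simp add: N_def)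
  have N: "finite_measure N"
  proof (rule finite_measureI)
    have "emeasure N (space N) = (\<integral>\<^sup>+x. indicator D x * indicator (space N) x \<partial>lborel)"
      unfolding N_def by (rule emeasure_density) (simp_all add: borel_measurable_indicator)
    also have "\<dots> = (\<integral>\<^sup>+x. indicator D x \<partial>lborel)" by (simp add: N_def)
    also have "\<dots> = emeasure lborel D" by simp
    finally show "emeasure N (space N) \<noteq> \<infinity>" using finite_emeasure_fattening by simp
  qed
  have N_int: "(LINT x|N. g x) = (LINT x|M. g x)" if "g \<in> borel_measurable borel" for g :: "_ \<Rightarrow> real"
    unfolding N_def by (rule lebesgue_on_density(1)[OF fattening_sets(1) that])
  have NN: "N \<Otimes>\<^sub>M N = density lborel (indicator (D \<times> D))"
    unfolding N_def by (rule density_indicator_Times[OF fattening_sets(1) N[unfolded N_def]])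
  have sq: "h \<in> square_integrable N" if "h \<in> borel_measurable borel" "\<And>x. a \<le> h x" "\<And>x. h x \<le> b" for h
  proof (rule square_integrable_bounded[OF N, where b = b])
    show "h \<in> borel_measurable N" using that(1) by (simp add: measurable_cong_sets[OF N_sets refl])
    show "\<bar>h x\<bar> \<le> b" for x using that(2,3)[of x] a by linarith
  qed
  have \<eta>sq: "\<eta> j \<in> square_integrable N" for j by (rule sq[OF \<eta> \<eta>b])
  have \<eta>C: "(LINT x|N. (\<eta> j x)\<^sup>2) \<le> b\<^sup>2 * measure N (space N)" for j
  proof -
    interpret finite_measure N by (rule N)
    have "(LINT x|N. (\<eta> j x)\<^sup>2) \<le> (LINT x|N. b\<^sup>2)"
    proof (rule integral_mono)
      show "integrable N (\<lambda>x. (\<eta> j x)\<^sup>2)" using \<eta>sq by (simp add: square_integrable_def)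
      show "(\<eta> j x)\<^sup>2 \<le> b\<^sup>2" for x
        using \<eta>b[of j x] \<eta>b(1)[of j x] a by (intro power_mono) auto
    qed simp
    then show ?thesis by (simp add: mult.commute)
  qed
  obtain F \<eta>' where F: "F \<noteq> bot" "F \<le> sequentially" and \<eta>': "\<eta>' \<in> square_integrable N"
    and wlim': "\<And>g. g \<in> square_integrable N \<Longrightarrow>
           ((\<lambda>j. LINT x|N. \<eta> j x * g x) \<longlongrightarrow> (LINT x|N. \<eta>' x * g x)) F"
    by (rule square_integrable_weak_cluster_point[OF \<eta>sq \<eta>C]) (rule that)
  have "AE x in N. a \<le> \<eta>' x"
    by (rule weak_limit_ge[OF N F(1) \<eta>sq \<eta>' wlim' \<eta>b(1)])
  moreover have "AE x in N. \<eta>' x \<le> b"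
    by (rule weak_limit_le[OF N F(1) \<eta>sq \<eta>' wlim' \<eta>b(2)])
  ultimately have \<eta>'b: "AE x in N. max a (min b (\<eta>' x)) = \<eta>' x"
    by eventually_elim auto
  \<comment> \<open>a representative of the weak limit that satisfies the bounds everywhere\<close>
  define \<eta>\<^sub>0 where "\<eta>\<^sub>0 x = max a (min b (\<eta>' x))" for x
  have \<eta>0 [measurable]: "\<eta>\<^sub>0 \<in> borel_measurable borel"
  proof -
    have "\<eta>' \<in> borel_measurable borel"
      using \<eta>' by (simp add: square_integrable_def measurable_cong_sets[OF N_sets refl])
    then show ?thesis unfolding \<eta>\<^sub>0_def by measurable
  qed
  have \<eta>0b: "a \<le> \<eta>\<^sub>0 x" "\<eta>\<^sub>0 x \<le> b" for x using ab by (auto simp: \<eta>\<^sub>0_def)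
  have wlim: "((\<lambda>j. LINT x|N. \<eta> j x * g x) \<longlongrightarrow> (LINT x|N. \<eta>\<^sub>0 x * g x)) F"
    if g: "g \<in> square_integrable N" for g
  proof -
    have "(LINT x|N. \<eta>\<^sub>0 x * g x) = (LINT x|N. \<eta>' x * g x)"
    proof (rule integral_cong_AE)
      show "(\<lambda>x. \<eta>\<^sub>0 x * g x) \<in> borel_measurable N" "(\<lambda>x. \<eta>' x * g x) \<in> borel_measurable N"
        using square_integrable_mult[OF sq[OF \<eta>0 \<eta>0b] g] square_integrable_mult[OF \<eta>' g] by auto
      show "AE x in N. \<eta>\<^sub>0 x * g x = \<eta>' x * g x"
        using \<eta>'b by eventually_elim (simp add: \<eta>\<^sub>0_def)
    qed
    then show ?thesis using wlim'[OF g] by simp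
  qed
  have \<eta>N: "\<eta> j \<in> borel_measurable N" "\<eta>\<^sub>0 \<in> borel_measurable N" for j
    using \<eta> \<eta>0 by (simp_all add: measurable_cong_sets[OF N_sets refl])

  define \<rho> where "\<rho> x = \<eta>\<^sub>0 x powr (2 / p)" for x
  have pos: "0 < \<eta>\<^sub>0 x" for x using \<eta>0b[of x] a by linarith
  have \<rho>_powr: "\<rho> x powr (p / 2) = \<eta>\<^sub>0 x" for x
    using pos[of x] p by (simp add: \<rho>_def powr_powr)
  have \<rho>_adm: "\<rho> \<in> ?Adm"
  proof -
    have [measurable]: "\<Omega> \<in> sets borel" "\<And>j. \<eta> j \<in> borel_measurable borel"
      using \<eta> by simp_all
    have \<rho>m: "\<rho> \<in> borel_measurable M"
    proof -
      have "\<rho> \<in> borel_measurable borel" unfolding \<rho>_def by measurable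
      then show ?thesis by (intro measurable_restrict_space1 measurable_completion) simp
    qed
    have "a powr (2 / p) = \<rho>min" "b powr (2 / p) = \<rho>max"
      using bounds p by (auto simp: a_def b_def powr_powr)
    then have \<rho>b: "\<rho>min \<le> \<rho> x" "\<rho> x \<le> \<rho>max" for x
      using powr_mono2[of "2 / p" a "\<eta>\<^sub>0 x"] powr_mono2[of "2 / p" "\<eta>\<^sub>0 x" b] \<eta>0b[of x] pos[of x] a p
      by (auto simp: \<rho>_def)
    have "(LINT x|N. indicator \<Omega> x * \<eta>\<^sub>0 x powr (2 / p)) \<le> \<gamma> * measure lebesgue \<Omega>"
    proof (rule weak_limit_integral_powr_le[OF N F(1) \<eta>N a \<eta>b \<eta>0b wlim])
      show "1 \<le> 2 / p" using p by simp
      show "\<Omega> \<in> sets N" by (simp add: N_sets)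
      fix j
      have "(LINT x|N. indicator \<Omega> x * \<eta> j x powr (2 / p)) = (LINT x|M. indicator \<Omega> x * \<eta> j x powr (2 / p))"
        by (rule N_int) measurable
      also have "\<dots> = (LINT x|M. indicator \<Omega> x * \<rho>s j x)"
      proof (rule integral_cong_AE)
        have \<Omega>M: "indicator \<Omega> \<in> borel_measurable M"
          by (intro measurable_restrict_space1 borel_measurable_indicator domain_sets)
        have \<eta>M: "\<eta> j \<in> borel_measurable M"
          using \<eta>[of j] by (intro measurable_restrict_space1 measurable_completion) simp
        have \<rho>M: "\<rho>s j \<in> borel_measurable M"
          using adm[of j] by (simp add: admissible_def Linf_on_def)
        show "(\<lambda>x. indicator \<Omega> x * \<eta> j x powr (2 / p)) \<in> borel_measurable M"
          using \<Omega>M \<eta>M by measurable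
        show "(\<lambda>x. indicator \<Omega> x * \<rho>s j x) \<in> borel_measurable M"
          using \<Omega>M \<rho>M by measurable
        have "AE x in M. \<rho>min \<le> \<rho>s j x" using adm[of j] by (auto simp: admissible_def)
        then show "AE x in M. indicator \<Omega> x * \<eta> j x powr (2 / p) = indicator \<Omega> x * \<rho>s j x"
          using \<eta>AE[of j]
        proof eventually_elim
          case (elim x)
          then have "\<eta> j x powr (2 / p) = \<rho>s j x"
            using bounds(1) p by (simp add: powr_powr flip: elim(2))
          then show ?case by simp
        qed
      qed
      also have "\<dots> \<le> \<gamma> * measure lebesgue \<Omega>"
        using adm[of j] by (simp add: admissible_def integral_domain_eq)
      finally show "(LINT x|N. indicator \<Omega> x * \<eta> j x powr (2 / p)) \<le> \<gamma> * measure lebesgue \<Omega>" .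
    qed
    also have "(LINT x|N. indicator \<Omega> x * \<eta>\<^sub>0 x powr (2 / p)) = (LINT x|lebesgue_on \<Omega>. \<rho> x)"
      unfolding integral_domain_eq \<rho>_def by (rule N_int) measurable
    finally have vol: "(LINT x|lebesgue_on \<Omega>. \<rho> x) \<le> \<gamma> * measure lebesgue \<Omega>" .
    have "\<bar>\<rho> x\<bar> \<le> \<rho>max" for x using \<rho>b[of x] bounds(1) by linarith
    then show ?thesis
      using \<rho>m \<rho>b vol by (auto simp: admissible_def Linf_on_def)
  qed
  obtain u where u: "(\<rho>, u) \<in> Fs" using state[OF \<rho>_adm] by blast
  have u0: "u \<in> ?U0" and uU: "u \<in> U_space \<Omega> A \<delta>" using u U0_space_subset by (auto simp: Fs_iff)

  have dqu: "integrable M2 (\<lambda>z. (dq u z)\<^sup>2)"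
    using uU by (simp add: U_space_iff square_integrable_def)
  \<comment> \<open>the fixed integrable function against which the coefficients are tested\<close>
  obtain w where w: "w \<in> borel_measurable borel" and wAE: "AE z in M2. (dq u z)\<^sup>2 = w z"
    by (rule borel_version[OF borel_measurable_integrable[OF dqu] fattening_sets2(2)])
  have wM2: "w \<in> borel_measurable M2"
    using w by (intro measurable_restrict_space1 measurable_completion) simp
  have "integrable M2 w"
    using integrable_cong_AE[OF borel_measurable_integrable[OF dqu] wM2 wAE] dqu by simp
  then have wN: "integrable (N \<Otimes>\<^sub>M N) w"
    unfolding NN lebesgue_on_density(2)[OF fattening_sets2(1) w] .
  have form_N: "form (design_coeff p \<sigma>) u u = (LINT z|(N \<Otimes>\<^sub>M N). h (fst z) * h (snd z) * w z)"
    if \<sigma>: "\<sigma> \<in> ?Adm" and h: "h \<in> borel_measurable borel" and AE: "AE x in M. \<sigma> x powr (p / 2) = h x" for \<sigma> h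
  proof -
    have hm: "(\<lambda>z. h (fst z) * h (snd z) * w z) \<in> borel_measurable borel"
    proof -
      have "fst \<in> borel_measurable (borel :: ((real ^ 'n) \<times> (real ^ 'n)) measure)"
           "snd \<in> borel_measurable (borel :: ((real ^ 'n) \<times> (real ^ 'n)) measure)"
        by (intro borel_measurable_continuous_onI continuous_intros)+
      then show ?thesis
        by (intro borel_measurable_times w measurable_compose[OF _ h])
    qed
    have "form (design_coeff p \<sigma>) u u = (LINT z|M2. h (fst z) * h (snd z) * w z)"
      unfolding form_eq
    proof (rule integral_cong_AE)
      show "(\<lambda>z. design_coeff p \<sigma> (fst z) (snd z) * (dq u z * dq u z)) \<in> borel_measurable M2"
        by (rule borel_measurable_integrable[OF form_integrable[OF ell[OF \<sigma>] uU uU]])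
      show "(\<lambda>z. h (fst z) * h (snd z) * w z) \<in> borel_measurable M2"
        using hm by (intro measurable_restrict_space1 measurable_completion) simp
      show "AE z in M2. design_coeff p \<sigma> (fst z) (snd z) * (dq u z * dq u z) = h (fst z) * h (snd z) * w z"
        using fst_AE_on[OF AE] snd_AE_on[OF AE] wAE
        by eventually_elim (simp add: power2_eq_square)
    qed
    then show ?thesis
      unfolding NN lebesgue_on_density(1)[OF fattening_sets2(1) hm] .
  qed
  have tensor: "((\<lambda>j. form (design_coeff p (\<rho>s j)) u u) \<longlongrightarrow> form (design_coeff p \<rho>) u u) F"
  proof -
    have "((\<lambda>j. LINT z|(N \<Otimes>\<^sub>M N). \<eta> j (fst z) * \<eta> j (snd z) * w z)
        \<longlongrightarrow> (LINT z|(N \<Otimes>\<^sub>M N). \<eta>\<^sub>0 (fst z) * \<eta>\<^sub>0 (snd z) * w z)) F"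
    proof (rule weak_limit_tensor[OF N \<eta>N _ _ wlim wN, where b = b])
      show "\<bar>\<eta> j x\<bar> \<le> b" for j x using \<eta>b(1)[of j x] \<eta>b(2)[of j x] a by linarith
      show "\<bar>\<eta>\<^sub>0 x\<bar> \<le> b" for x using \<eta>0b[of x] a by linarith
    qed
    then show ?thesis
      using form_N[OF adm \<eta> \<eta>AE] form_N[OF \<rho>_adm \<eta>0] \<rho>_powr by simp
  qed
  have "load \<Omega> f u \<le> m"
  proof (rule tendsto_le[OF F(1)])
    show "((\<lambda>j. load \<Omega> f (us j)) \<longlongrightarrow> m) F" using Jlim F(2) by (rule tendsto_mono[rotated])
    have "form (design_coeff p \<rho>) u u = load \<Omega> f u" using u u0 by (simp add: Fs_iff)
    then show "((\<lambda>j. 2 * load \<Omega> f u - form (design_coeff p (\<rho>s j)) u u) \<longlongrightarrow> load \<Omega> f u) F"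
      using tendsto_diff[OF tendsto_const tensor, of "2 * load \<Omega> f u"] by simp
    show "\<forall>\<^sub>F j in F. 2 * load \<Omega> f u - form (design_coeff p (\<rho>s j)) u u \<le> load \<Omega> f (us j)"
      using lower[OF Xs u0] by simp
  qed
  then have "optimal \<Omega> A \<delta> \<rho>min \<rho>max \<gamma> p f \<rho> u"
    unfolding optimal_def using u m_le by (fastforce simp: Fs_def[symmetric])
  then show ?thesis by blast
qed

end

theorem proposition6:
  fixes \<Omega> :: "(real ^ 'n) set"
    and A :: "real \<Rightarrow> real \<Rightarrow> real"
    and f :: "real ^ 'n \<Rightarrow> real"
    and \<delta> \<rho>min \<rho>max \<gamma> p :: real
  assumes dim: "CARD('n) \<ge> 2"
    and domain: "open \<Omega>" "bounded \<Omega>" "connected \<Omega>"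
    and kernel_nonneg: "\<And>d r. d > 0 \<Longrightarrow> r \<ge> 0 \<Longrightarrow> A d r \<ge> 0"
    and kernel_normalized: "\<And>d. d > 0 \<Longrightarrow>
          1 / real CARD('n) * (LINT x|lebesgue. A d (norm (x :: real ^ 'n))) = 1"
    and kernel_supp: "\<And>d. d > 0 \<Longrightarrow> supp (\<lambda>x :: real ^ 'n. A d (norm x)) \<subseteq> ball 0 d"
    and kernel_lower: "\<exists>s. 0 < s \<and> s < 1 \<and> (\<forall>d>0. \<exists>c>0. \<forall>x\<in>ball (0 :: real ^ 'n) (d / 2) - {0}.
          A d (norm x) \<ge> c * norm x powr (- (real CARD('n) + 2 * s - 2)))"
    and bounds: "0 < \<rho>min" "\<rho>min < \<rho>max" "\<rho>min < \<gamma>" "\<gamma> < \<rho>max"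
    and delta: "\<delta> > 0"
    and f: "f \<in> L2_on \<Omega>"
    and p: "1 < p" "p \<le> 2"
  shows "\<exists>\<rho>\<in>admissible \<Omega> \<delta> \<rho>min \<rho>max \<gamma>. \<exists>u\<in>U0_space \<Omega> A \<delta>.
           optimal \<Omega> A \<delta> \<rho>min \<rho>max \<gamma> p f \<rho> u"
proof -
  interpret nonlocal_kernel \<Omega> A \<delta>
  proof
    show "integrable lebesgue (\<lambda>x :: real ^ 'n. A \<delta> (norm x))"
    proof (rule ccontr)
      assume "\<not> integrable lebesgue (\<lambda>x :: real ^ 'n. A \<delta> (norm x))"
      then show False using kernel_normalized[OF delta] by (simp add: not_integrable_integral_eq)
    qed
    obtain s c where s: "0 < s" and c: "0 < c"
      and low: "\<And>x :: real ^ 'n. x \<in> ball 0 (\<delta> / 2) - {0} \<Longrightarrow>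
        c * norm x powr (- (real CARD('n) + 2 * s - 2)) \<le> A \<delta> (norm x)"
      using kernel_lower delta by blast
    define e where "e = - (real CARD('n) + 2 * s - 2)"
    have e: "e \<le> 0" using dim s by (simp add: e_def)
    show "\<exists>c>0. \<forall>x :: real ^ 'n. x \<noteq> 0 \<longrightarrow> norm x < \<delta> / 2 \<longrightarrow> c \<le> A \<delta> (norm x)"
    proof (intro exI[of _ "c * (\<delta> / 2) powr e"] conjI allI impI)
      show "0 < c * (\<delta> / 2) powr e" using c delta by simp
      fix x :: "real ^ 'n" assume x: "x \<noteq> 0" "norm x < \<delta> / 2"
      have "(\<delta> / 2) powr e \<le> norm x powr e"
        using x e by (intro powr_mono2') auto
      then have "c * (\<delta> / 2) powr e \<le> c * norm x powr e" using c by simp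
      also have "\<dots> \<le> A \<delta> (norm x)" using low[of x] x by (simp add: e_def)
      finally show "c * (\<delta> / 2) powr e \<le> A \<delta> (norm x)" .
    qed
  qed (use domain delta kernel_nonneg in auto)
  obtain \<rho> u where opt: "optimal \<Omega> A \<delta> \<rho>min \<rho>max \<gamma> p f \<rho> u"
    using exists_optimal_design[of \<rho>min \<rho>max \<gamma> p f] bounds p f by auto
  then have "\<rho> \<in> admissible \<Omega> \<delta> \<rho>min \<rho>max \<gamma>" "u \<in> U0_space \<Omega> A \<delta>"
    by (auto simp: optimal_def feasible_def)
  with opt show ?thesis by blast
qed

end
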